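(* Let $X$ and $Y$ be Banach spaces and let $S:X\to Y$ be a continuous linear operator which is not compact and whose image $S(X)$ is dense in $Y$. Then there exists a continuous linear operator $T:Y\to c_0$ such that the composition $TS:X\to c_0$ is not compact.
   Context: $c_0$ denotes the Banach space of all scalar sequences $(a_n)_{n\in\omega}$ converging to zero, with the supremum norm, where $\omega=\{0,1,2,\dots\}$. A continuous linear operator between Banach spaces is compact if the image of the closed unit ball is totally bounded (equivalently, has compact closure). *)

theory Defs
  imports "HOL-Analysis.Analysis"
begin

text \<open>
  The scalar field is a type of sort \<open>{real_normed_field, euclidean_space}\<close>. Its instances include
  \<^typ>\<open>real\<close> and \<^typ>\<open>complex\<close>, and by Frobenius' theorem every instance is
  isometrically isomorphic to one of these two. A Banach space over the scalar field is a type of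
  class \<^class>\<open>banach\<close> with a scalar multiplication satisfying the following locale.
\<close>

locale normed_space_over = vector_space scale
  for scale :: "'k::real_normed_field \<Rightarrow> 'a::real_normed_vector \<Rightarrow> 'a" +
  assumes norm_scale: "norm (scale c x) = norm c * norm x"
    and scale_of_real: "scale (of_real r) x = r *\<^sub>R x"

lemma normed_space_over_scaleR:
  "normed_space_over (scaleR :: real \<Rightarrow> 'a::real_normed_vector \<Rightarrow> 'a)"
  by unfold_locales (auto simp: algebra_simps)

lemma normed_space_over_times:
  "normed_space_over (times :: 'k::real_normed_field \<Rightarrow> 'k \<Rightarrow> 'k)"
  by unfold_locales (auto simp: algebra_simps norm_mult scaleR_conv_of_real)

text \<open>
  Applied to continuous linear maps only. Since total boundedness of a set does not depend on the
  ambient space, this is relative compactness of the image when the target is complete.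
\<close>

definition compact_operator :: "('a::real_normed_vector \<Rightarrow> 'b::real_normed_vector) \<Rightarrow> bool"
  where "compact_operator f \<longleftrightarrow> totally_bounded (f ` cball 0 1)"

typedef (overloaded) 'a c0 = "{a :: nat \<Rightarrow> 'a::real_normed_vector. a \<longlonglongrightarrow> 0}"
  morphisms c0_nth Abs_c0
  by (rule exI[of _ "\<lambda>_. 0"]) simp

setup_lifting type_definition_c0

lemma c0_tendsto: "c0_nth a \<longlonglongrightarrow> 0"
  using c0_nth[of a] by simp

lemma c0_eqI: "(\<And>n. c0_nth a n = c0_nth b n) \<Longrightarrow> a = b"
  by (simp add: c0_nth_inject[symmetric] fun_eq_iff)

lemma c0_bdd_above: "bdd_above (range (\<lambda>n. norm (c0_nth a n)))"
proof -
  have "Bseq (c0_nth a)"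
    using c0_tendsto convergentI convergent_imp_Bseq by blast
  then show ?thesis
    unfolding Bseq_def bdd_above_def by auto
qed

instantiation c0 :: (real_normed_vector) real_vector
begin

lift_definition zero_c0 :: "'a c0" is "\<lambda>_. 0"
  by simp

lift_definition plus_c0 :: "'a c0 \<Rightarrow> 'a c0 \<Rightarrow> 'a c0" is "\<lambda>a b n. a n + b n"
  using tendsto_add by fastforce

lift_definition minus_c0 :: "'a c0 \<Rightarrow> 'a c0 \<Rightarrow> 'a c0" is "\<lambda>a b n. a n - b n"
  using tendsto_diff by fastforce

lift_definition uminus_c0 :: "'a c0 \<Rightarrow> 'a c0" is "\<lambda>a n. - a n"
  using tendsto_minus by fastforce

lift_definition scaleR_c0 :: "real \<Rightarrow> 'a c0 \<Rightarrow> 'a c0" is "\<lambda>r a n. r *\<^sub>R a n"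
  using tendsto_scaleR[OF tendsto_const] by fastforce

instance
proof
  fix a b c :: "'a c0" and r s :: real
  show "a + b + c = a + (b + c)" by transfer (simp add: add.assoc)
  show "a + b = b + a" by transfer (simp add: add.commute)
  show "0 + a = a" by transfer simp
  show "- a + a = 0" by transfer simp
  show "a - b = a + - b" by transfer simp
  show "r *\<^sub>R (a + b) = r *\<^sub>R a + r *\<^sub>R b" by transfer (simp add: scaleR_add_right)
  show "(r + s) *\<^sub>R a = r *\<^sub>R a + s *\<^sub>R a" by transfer (simp add: scaleR_add_left)
  show "r *\<^sub>R s *\<^sub>R a = (r * s) *\<^sub>R a" by transfer simp
  show "1 *\<^sub>R a = a" by transfer simp
qed

end

instantiation c0 :: (real_normed_vector) real_normed_vector
begin

definition norm_c0 :: "'a c0 \<Rightarrow> real"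
  where "norm_c0 a = (SUP n. norm (c0_nth a n))"

definition dist_c0 :: "'a c0 \<Rightarrow> 'a c0 \<Rightarrow> real"
  where "dist_c0 a b = norm (a - b)"

definition sgn_c0 :: "'a c0 \<Rightarrow> 'a c0"
  where "sgn_c0 a = a /\<^sub>R norm a"

definition uniformity_c0 :: "('a c0 \<times> 'a c0) filter"
  where "uniformity_c0 = (INF e\<in>{0<..}. principal {(a, b). dist a b < e})"

definition open_c0 :: "'a c0 set \<Rightarrow> bool"
  where "open_c0 U \<longleftrightarrow> (\<forall>a\<in>U. \<forall>\<^sub>F (a', b) in uniformity. a' = a \<longrightarrow> b \<in> U)"

lemma norm_c0_nth_le: "norm (c0_nth a n) \<le> norm a" for a :: "'a c0"
  unfolding norm_c0_def by (rule cSUP_upper[OF _ c0_bdd_above]) simp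

lemma norm_c0_leI: "(\<And>n. norm (c0_nth a n) \<le> r) \<Longrightarrow> norm a \<le> r" for a :: "'a c0"
  unfolding norm_c0_def by (rule cSUP_least) auto

instance
proof
  fix a b :: "'a c0" and r :: real
  show "dist a b = norm (a - b)" by (rule dist_c0_def)
  show "sgn a = a /\<^sub>R norm a" by (rule sgn_c0_def)
  show "uniformity = (INF e\<in>{0<..}. principal {(a :: 'a c0, b). dist a b < e})"
    by (rule uniformity_c0_def)
  show "open U \<longleftrightarrow> (\<forall>a\<in>U. \<forall>\<^sub>F (a', b) in uniformity. a' = a \<longrightarrow> b \<in> U)" for U :: "'a c0 set"
    by (rule open_c0_def)
  show "norm a = 0 \<longleftrightarrow> a = 0"
  proof
    assume "norm a = 0"
    then have "c0_nth a n = 0" for n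
      using norm_c0_nth_le[of a n] by simp
    then show "a = 0" by (intro c0_eqI) (simp add: zero_c0.rep_eq)
  qed (simp add: norm_c0_def zero_c0.rep_eq)
  show "norm (a + b) \<le> norm a + norm b"
  proof (rule norm_c0_leI)
    fix n
    show "norm (c0_nth (a + b) n) \<le> norm a + norm b"
      unfolding plus_c0.rep_eq by (intro norm_triangle_mono norm_c0_nth_le)
  qed
  have le: "norm (t *\<^sub>R d) \<le> \<bar>t\<bar> * norm d" for t and d :: "'a c0"
    by (rule norm_c0_leI) (simp add: scaleR_c0.rep_eq mult_left_mono norm_c0_nth_le)
  show "norm (r *\<^sub>R a) = \<bar>r\<bar> * norm a"
  proof (cases "r = 0")
    case True
    have "0 *\<^sub>R a = 0" by transfer simp
    then show ?thesis using True by (simp add: norm_c0_def zero_c0.rep_eq)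
  next
    case False
    have "inverse r *\<^sub>R r *\<^sub>R a = a" using False by transfer simp
    then have "norm a \<le> \<bar>inverse r\<bar> * norm (r *\<^sub>R a)"
      using le[of "inverse r" "r *\<^sub>R a"] by simp
    then have "\<bar>r\<bar> * norm a \<le> norm (r *\<^sub>R a)"
      using False by (simp add: field_simps)
    then show ?thesis using le[of r a] by simp
  qed
qed

end

instance c0 :: (banach) banach
proof
  fix X :: "nat \<Rightarrow> 'a c0"
  assume X: "Cauchy X"
  have "Cauchy (\<lambda>k. c0_nth (X k) n)" for n
  proof (rule metric_CauchyI)
    fix e :: real assume "e > 0"
    then obtain M where M: "\<forall>k\<ge>M. \<forall>l\<ge>M. dist (X k) (X l) < e"
      using metric_CauchyD[OF X] by blast
    have "dist (c0_nth (X k) n) (c0_nth (X l) n) \<le> dist (X k) (X l)" for k l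
      using norm_c0_nth_le[of "X k - X l" n] by (simp add: dist_norm minus_c0.rep_eq)
    then show "\<exists>M. \<forall>k\<ge>M. \<forall>l\<ge>M. dist (c0_nth (X k) n) (c0_nth (X l) n) < e"
      using M by (meson le_less_trans)
  qed
  then have "\<exists>y. (\<lambda>k. c0_nth (X k) n) \<longlonglongrightarrow> y" for n
    by (simp add: Cauchy_convergent convergentD)
  then obtain y where y: "\<And>n. (\<lambda>k. c0_nth (X k) n) \<longlonglongrightarrow> y n"
    by metis
  have unif: "\<exists>M. \<forall>k\<ge>M. \<forall>n. norm (c0_nth (X k) n - y n) \<le> e" if "e > 0" for e :: real
  proof -
    obtain M where M: "\<forall>k\<ge>M. \<forall>l\<ge>M. dist (X k) (X l) < e"
      using metric_CauchyD[OF X \<open>e > 0\<close>] by blast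
    have "norm (c0_nth (X k) n - y n) \<le> e" if "k \<ge> M" for k n
    proof (rule Lim_bounded)
      show "(\<lambda>l. norm (c0_nth (X k) n - c0_nth (X l) n)) \<longlonglongrightarrow> norm (c0_nth (X k) n - y n)"
        by (intro tendsto_intros y)
      show "\<forall>l\<ge>M. norm (c0_nth (X k) n - c0_nth (X l) n) \<le> e"
      proof (intro allI impI)
        fix l assume "l \<ge> M"
        then have "norm (X k - X l) < e" using M \<open>k \<ge> M\<close> by (simp add: dist_norm)
        then show "norm (c0_nth (X k) n - c0_nth (X l) n) \<le> e"
          using norm_c0_nth_le[of "X k - X l" n] by (simp add: minus_c0.rep_eq)
      qed
    qed
    then show ?thesis by blast
  qed
  have "y \<longlonglongrightarrow> 0"
  proof (rule LIMSEQ_I)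
    fix e :: real assume "e > 0"
    then obtain M where M: "\<forall>k\<ge>M. \<forall>n. norm (c0_nth (X k) n - y n) \<le> e / 2"
      using unif[of "e / 2"] by auto
    obtain N where N: "\<forall>n\<ge>N. norm (c0_nth (X M) n - 0) < e / 2"
      using LIMSEQ_D[OF c0_tendsto[of "X M"], of "e / 2"] \<open>e > 0\<close> by auto
    have "norm (y n - 0) < e" if "n \<ge> N" for n
    proof -
      have "norm (c0_nth (X M) n - y n) \<le> e / 2" "norm (c0_nth (X M) n) < e / 2"
        using M N that by auto
      then show ?thesis
        using norm_triangle_ineq4[of "c0_nth (X M) n" "c0_nth (X M) n - y n"] by simp
    qed
    then show "\<exists>N. \<forall>n\<ge>N. norm (y n - 0) < e" by blast
  qed
  then have nth: "c0_nth (Abs_c0 y) = y"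
    by (simp add: Abs_c0_inverse)
  have "X \<longlonglongrightarrow> Abs_c0 y"
  proof (rule LIMSEQ_I)
    fix e :: real assume "e > 0"
    then obtain M where M: "\<forall>k\<ge>M. \<forall>n. norm (c0_nth (X k) n - y n) \<le> e / 2"
      using unif[of "e / 2"] by auto
    have "norm (X k - Abs_c0 y) < e" if "k \<ge> M" for k
    proof -
      have "norm (X k - Abs_c0 y) \<le> e / 2"
        by (rule norm_c0_leI) (use M that in \<open>simp add: minus_c0.rep_eq nth\<close>)
      then show ?thesis using \<open>e > 0\<close> by simp
    qed
    then show "\<exists>M. \<forall>k\<ge>M. norm (X k - Abs_c0 y) < e" by blast
  qed
  then show "convergent X" by (rule convergentI)
qed

lift_definition scale_c0 :: "'k::real_normed_field \<Rightarrow> 'k c0 \<Rightarrow> 'k c0" is "\<lambda>c a n. c * a n"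
  using tendsto_mult_right_zero by blast

lemma normed_space_over_scale_c0:
  "normed_space_over (scale_c0 :: 'k::real_normed_field \<Rightarrow> 'k c0 \<Rightarrow> 'k c0)"
proof
  fix a b :: "'k c0" and c d :: 'k and r :: real
  show "scale_c0 c (a + b) = scale_c0 c a + scale_c0 c b" by transfer (simp add: ring_distribs)
  show "scale_c0 (c + d) a = scale_c0 c a + scale_c0 d a" by transfer (simp add: ring_distribs)
  show assoc: "scale_c0 c (scale_c0 d a) = scale_c0 (c * d) a" for c d a
    by transfer (simp add: mult.assoc)
  show one: "scale_c0 1 a = a" for a by transfer simp
  show "scale_c0 (of_real r) a = r *\<^sub>R a" by transfer (simp add: scaleR_conv_of_real)
  have le: "norm (scale_c0 t x) \<le> norm t * norm x" for t and x :: "'k c0"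
    by (rule norm_c0_leI) (simp add: scale_c0.rep_eq norm_mult mult_left_mono norm_c0_nth_le)
  show "norm (scale_c0 c a) = norm c * norm a"
  proof (cases "c = 0")
    case True
    have "scale_c0 0 a = 0" by transfer simp
    then show ?thesis using True by simp
  next
    case False
    then have "norm a \<le> inverse (norm c) * norm (scale_c0 c a)"
      using le[of "inverse c" "scale_c0 c a"] by (simp add: assoc one norm_inverse)
    then have "norm c * norm a \<le> norm (scale_c0 c a)"
      using False by (simp add: field_simps)
    then show ?thesis using le[of c a] by simp
  qed
qed

end

theory Submission imports Defs begin

text \<open>
  Write \<open>C\<close> for the image of the unit ball under \<open>S\<close>. An operator into \<open>c\<^sub>0\<close> is a bounded weak* null
  sequence of functionals, and its composition with \<open>S\<close> is compact iff the sequence is uniformly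
  null on \<open>C\<close>. Since the range of \<open>S\<close> is dense, a bounded sequence is weak* null as soon as it is
  null on \<open>C\<close>. So suppose that every bounded sequence of functionals that is pointwise null on \<open>C\<close> is
  uniformly null on \<open>C\<close>; we derive that \<open>C\<close> is totally bounded. Two cases arise for a sequence \<open>f\<close>
  in the unit ball of the dual.

  Some sequence \<open>g\<close> of convex blocks of \<open>f\<close> has the property that each of its own convex block
  sequences oscillates by more than a fixed \<open>d > 0\<close> at a point of \<open>C\<close>. Replacing a sequence by
  averages and half differences of its terms then yields, as for Rademacher functions, functionals
  \<open>\<psi>\<^sub>i\<close> and points \<open>y\<^sub>i \<in> C\<close> with \<open>\<psi>\<^sub>i(y\<^sub>i) \<ge> d/2\<close> and \<open>\<Sum>\<^sub>i \<psi>\<^sub>i(z)\<^sup>2 \<le> \<parallel>z\<parallel>\<^sup>2\<close> for all \<open>z\<close>: a weak* null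
  sequence that is not uniformly null on \<open>C\<close>.

  Otherwise a diagonal argument gives convex blocks of \<open>f\<close> that converge pointwise on \<open>C\<close>, hence
  uniformly. If this holds for all \<open>f\<close>, an argument in the style of Eberlein and Shmulyan shows that
  \<open>f\<close> has a subsequence converging on \<open>C\<close>: choose it convergent on a countable set that norms the
  span of \<open>f\<close>, and note that the block limits of any two of its subsequences agree on that set. By
  Schauder's theorem \<open>C\<close> is then totally bounded.
\<close>

subsection \<open>Norming functionals\<close>

definition sublinear :: "('a::real_vector \<Rightarrow> real) \<Rightarrow> bool"
  where "sublinear p \<longleftrightarrow> (\<forall>x y. p (x + y) \<le> p x + p y) \<and> (\<forall>r\<ge>0. \<forall>x. p (r *\<^sub>R x) = r * p x)"

lemma sublinearI:
  assumes "\<And>x y. p (x + y) \<le> p x + p y" "\<And>r x. r > 0 \<Longrightarrow> p (r *\<^sub>R x) \<le> r * p x" "p 0 = 0"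
  shows "sublinear p"
proof -
  have "p (r *\<^sub>R x) = r * p x" if "r > 0" for r x
  proof -
    have "p (inverse r *\<^sub>R (r *\<^sub>R x)) \<le> inverse r * p (r *\<^sub>R x)"
      using that by (intro assms) simp
    then have "r * p x \<le> p (r *\<^sub>R x)"
      using that by (simp add: field_simps)
    then show ?thesis using assms(2)[OF that, of x] by simp
  qed
  then show ?thesis
    unfolding sublinear_def using assms(1,3) by (auto simp: le_less)
qed

lemma sublinear_add: "sublinear p \<Longrightarrow> p (x + y) \<le> p x + p y"
  and sublinear_scaleR: "sublinear p \<Longrightarrow> r \<ge> 0 \<Longrightarrow> p (r *\<^sub>R x) = r * p x"
  by (auto simp: sublinear_def)

lemma sublinear_0: "sublinear p \<Longrightarrow> p 0 = 0"
  using sublinear_scaleR[of p 0 0] by simp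

lemma sublinear_minus: "sublinear p \<Longrightarrow> - p (- x) \<le> p x"
  using sublinear_add[of p x "- x"] sublinear_0[of p] by simp

text \<open>
  If \<open>p\<close> is minimal among the sublinear functionals, then \<open>shift p y = p\<close> for all \<open>y\<close>, and this
  forces \<open>p\<close> to be additive.
\<close>

definition shift :: "('a::real_vector \<Rightarrow> real) \<Rightarrow> 'a \<Rightarrow> 'a \<Rightarrow> real"
  where "shift p y x = (INF t\<in>{0..}. p (x + t *\<^sub>R y) - t * p y)"

lemma shift_le:
  assumes "sublinear p" "t \<ge> 0"
  shows "shift p y x \<le> p (x + t *\<^sub>R y) - t * p y"
proof -
  \<comment> \<open>Subadditivity at \<open>- x\<close> and \<open>x + t y\<close> bounds the
    competitors from below by a number free of \<open>t\<close>, so the infimum is a genuine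
    one.\<close>
  have "- p (- x) \<le> p (x + t *\<^sub>R y) - t * p y" if "t \<ge> 0" for t
    using sublinear_add[OF assms(1), of "- x" "x + t *\<^sub>R y"] sublinear_scaleR[OF assms(1) that, of y]
    by simp
  then have "bdd_below ((\<lambda>t. p (x + t *\<^sub>R y) - t * p y) ` {0..})"
    by (intro bdd_belowI2[where m = "- p (- x)"]) simp
  then show ?thesis
    unfolding shift_def using assms(2) by (intro cINF_lower) auto
qed

lemma shift_greatest:
  assumes "\<And>t. t \<ge> 0 \<Longrightarrow> c \<le> p (x + t *\<^sub>R y) - t * p y"
  shows "c \<le> shift p y x"
  unfolding shift_def by (rule cINF_greatest) (use assms in auto)

text \<open>Parameters \<open>s\<close> for \<open>x\<close> and \<open>t\<close> for
  \<open>z\<close> combine to the parameter \<open>s + t\<close> for \<open>x + z\<close>; under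
  scaling of the vector by \<open>r\<close> the parameter scales along.\<close>

lemma sublinear_shift:
  assumes p: "sublinear p"
  shows "sublinear (shift p y)"
proof (rule sublinearI)
  fix x z
  have "shift p y (x + z) - (p (x + s *\<^sub>R y) - s * p y) \<le> p (z + t *\<^sub>R y) - t * p y"
    if "s \<ge> 0" "t \<ge> 0" for s t
    using shift_le[OF p, of "s + t" y "x + z"] sublinear_add[OF p, of "x + s *\<^sub>R y" "z + t *\<^sub>R y"] that
    by (simp add: algebra_simps)
  then have "shift p y (x + z) - (p (x + s *\<^sub>R y) - s * p y) \<le> shift p y z" if "s \<ge> 0" for s
    using that by (intro shift_greatest) auto
  then have "shift p y (x + z) - shift p y z \<le> p (x + s *\<^sub>R y) - s * p y" if "s \<ge> 0" for s
    using that by (force simp: algebra_simps)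
  then have "shift p y (x + z) - shift p y z \<le> shift p y x"
    by (intro shift_greatest) auto
  then show "shift p y (x + z) \<le> shift p y x + shift p y z" by simp
next
  fix r :: real and x assume r: "r > 0"
  have "shift p y (r *\<^sub>R x) / r \<le> p (x + t *\<^sub>R y) - t * p y" if "t \<ge> 0" for t
    using shift_le[OF p, of "r * t" y "r *\<^sub>R x"] sublinear_scaleR[OF p, of r "x + t *\<^sub>R y"] r that
    by (simp add: field_simps scaleR_add_right)
  then have "shift p y (r *\<^sub>R x) / r \<le> shift p y x"
    by (intro shift_greatest) auto
  then show "shift p y (r *\<^sub>R x) \<le> r * shift p y x"
    using r by (simp add: field_simps)
next
  have "shift p y 0 \<le> 0"
    using shift_le[OF p, of 0 y 0] sublinear_0[OF p] by simp
  moreover have "0 \<le> shift p y 0"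
    by (rule shift_greatest) (simp add: sublinear_scaleR[OF p])
  ultimately show "shift p y 0 = 0" by simp
qed

text \<open>Zorn's lemma for the reversed order: a chain is bounded by its pointwise infimum, which
  is finite because every sublinear \<open>q\<close> below \<open>p\<close> satisfies
  \<open>- p (- x) <= q x\<close>.\<close>

lemma minimal_sublinear_ex:
  fixes p :: "'a::real_vector \<Rightarrow> real"
  assumes p: "sublinear p"
  obtains m where "sublinear m" "m \<le> p" "\<And>q. sublinear q \<Longrightarrow> q \<le> m \<Longrightarrow> q = m"
proof -
  define A where "A = {q. sublinear q \<and> q \<le> p}"
  have "\<exists>m\<in>A. \<forall>a\<in>A. m \<ge> a \<longrightarrow> a = m"
  proof (rule predicate_Zorn)
    show "partial_order_on A (relation_of (\<ge>) A)"
      by (rule partial_order_on_relation_ofI) auto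
  next
    fix C assume "C \<in> Chains (relation_of (\<ge>) A)"
    then have CA: "C \<subseteq> A" and ch: "\<And>a b. a \<in> C \<Longrightarrow> b \<in> C \<Longrightarrow> a \<le> b \<or> b \<le> a"
      by (auto simp: Chains_def relation_of_def)
    show "\<exists>u\<in>A. \<forall>a\<in>C. a \<ge> u"
    proof (cases "C = {}")
      case True
      then show ?thesis using p by (auto simp: A_def)
    next
      case False
      define u where "u x = (INF q\<in>C. q x)" for x
      have "- p (- x) \<le> q x" if "q \<in> C" for q x
      proof -
        have "sublinear q" "q (- x) \<le> p (- x)"
          using that CA by (auto simp: A_def le_fun_def)
        then show ?thesis using sublinear_minus[of q x] by linarith
      qed
      then have bdd: "bdd_below ((\<lambda>q. q x) ` C)" for x
        by (meson bdd_belowI2)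
      have le: "u x \<le> q x" if "q \<in> C" for q x
        unfolding u_def using bdd that by (rule cINF_lower)
      have gr: "c \<le> u x" if "\<And>q. q \<in> C \<Longrightarrow> c \<le> q x" for c x
        unfolding u_def using False that by (rule cINF_greatest)
      have sub: "sublinear q" if "q \<in> C" for q
        using that CA by (auto simp: A_def)
      have "sublinear u"
      proof (rule sublinearI)
        fix x y
        have "u (x + y) - a x \<le> b y" if ab: "a \<in> C" "b \<in> C" for a b
        proof -
          obtain c where "c \<in> C" "c \<le> a" "c \<le> b"
            using ch[of a b] ab by blast
          then have "u (x + y) \<le> c x + c y" "c x \<le> a x" "c y \<le> b y"
            using le[of c "x + y"] sublinear_add[OF sub, of c x y] by (auto simp: le_fun_def)
          then show ?thesis by simp
        qed
        then have "u (x + y) - a x \<le> u y" if "a \<in> C" for a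
          using that by (intro gr) auto
        then have "u (x + y) - u y \<le> a x" if "a \<in> C" for a
          using that by (force simp: algebra_simps)
        then have "u (x + y) - u y \<le> u x"
          by (intro gr) auto
        then show "u (x + y) \<le> u x + u y" by simp
      next
        fix r :: real and x assume r: "r > 0"
        have "u (r *\<^sub>R x) / r \<le> a x" if "a \<in> C" for a
          using le[OF that, of "r *\<^sub>R x"] sublinear_scaleR[OF sub[OF that], of r x] r
          by (simp add: field_simps)
        then have "u (r *\<^sub>R x) / r \<le> u x"
          by (intro gr) auto
        then show "u (r *\<^sub>R x) \<le> r * u x"
          using r by (simp add: field_simps)
      next
        show "u 0 = 0"
          unfolding u_def using False by (simp add: sublinear_0[OF sub] cong: INF_cong_simp)
      qed
      moreover have "u \<le> p"
      proof -
        obtain a where "a \<in> C" using False by blast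
        then have "u \<le> a" "a \<le> p" using le CA by (auto simp: le_fun_def A_def)
        then show ?thesis by simp
      qed
      ultimately show ?thesis
        using le by (auto simp: A_def le_fun_def)
    qed
  qed
  then show thesis
    using that unfolding A_def by (auto intro: order_trans)
qed

lemma minimal_sublinear_linear:
  assumes m: "sublinear m" and min: "\<And>q. sublinear q \<Longrightarrow> q \<le> m \<Longrightarrow> q = m"
  shows "linear m"
proof -
  have "shift m y = m" for y
  proof (rule min)
    show "sublinear (shift m y)" using m by (rule sublinear_shift)
    show "shift m y \<le> m"
      using shift_le[OF m, of 0] by (auto simp: le_fun_def)
  qed
  \<comment> \<open>The parameter 1 in the infimum gives superadditivity, the converse of
    \<open>sublinear_add\<close>.\<close>
  then have "m x \<le> m (x + y) - m y" for x y
    using shift_le[OF m, of 1 y x] by simp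
  then have add: "m (x + y) = m x + m y" for x y
    using sublinear_add[OF m, of x y] by (smt (verit))
  have neg: "m (- x) = - m x" for x
    using add[of x "- x"] sublinear_0[OF m] by simp
  have "m (r *\<^sub>R x) = r * m x" for r x
  proof (cases "r \<ge> 0")
    case True
    then show ?thesis using sublinear_scaleR[OF m] by simp
  next
    case False
    then show ?thesis
      using sublinear_scaleR[OF m, of "- r" x] neg[of "r *\<^sub>R x"] by simp
  qed
  with add show ?thesis by (intro linearI) auto
qed

text \<open>Hahn-Banach for one vector. Taking the minimal functional below
  \<open>shift norm y\<close> rather than below \<open>norm\<close> fixes its value at
  \<open>y\<close>: the parameter 1 at \<open>- y\<close> gives \<open>m (- y) <= - norm y\<close>,
  and \<open>m <= norm\<close> gives the reverse estimate.\<close>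

theorem norming_functional:
  fixes y :: "'a::real_normed_vector"
  obtains f :: "'a \<Rightarrow>\<^sub>L real" where "norm f \<le> 1" "blinfun_apply f y = norm y"
proof -
  have norm: "sublinear (norm :: 'a \<Rightarrow> real)"
    by (auto simp: sublinear_def norm_triangle_ineq)
  obtain m where m: "sublinear m" "m \<le> shift norm y" "\<And>q. sublinear q \<Longrightarrow> q \<le> m \<Longrightarrow> q = m"
    using minimal_sublinear_ex[OF sublinear_shift[OF norm]] by metis
  interpret linear m using m(1,3) by (rule minimal_sublinear_linear)
  have le: "m x \<le> norm x" for x
    using m(2) shift_le[OF norm, of 0 y x] by (auto simp: le_fun_def intro: order_trans)
  have abs: "\<bar>m x\<bar> \<le> norm x" for x
    using le[of x] le[of "- x"] by (simp add: neg)
  then have "bounded_linear m"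
    by unfold_locales (auto intro!: exI[of _ 1])
  then have app: "blinfun_apply (Blinfun m) = m"
    by (rule bounded_linear_Blinfun_apply)
  have "m (- y) \<le> - norm y"
    using m(2) shift_le[OF norm, of 1 y "- y"] by (auto simp: le_fun_def intro: order_trans)
  then have "m y = norm y"
    using le[of y] by (simp add: neg)
  moreover have "norm (Blinfun m) \<le> 1"
    by (rule norm_blinfun_bound) (simp_all add: app abs)
  ultimately show thesis using that[of "Blinfun m"] by (simp add: app)
qed

subsection \<open>Convex blocks\<close>

text \<open>Block \<open>n\<close> may use any terms of index at least \<open>n\<close>, and blocks
  may overlap. In this form the relation is transitive and passes to subsequences, averages and
  diagonals.\<close>

definition convex_block :: "(nat \<Rightarrow> 'a::real_vector) \<Rightarrow> (nat \<Rightarrow> 'a) \<Rightarrow> bool"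
  where "convex_block h f \<longleftrightarrow> (\<forall>n. h n \<in> convex hull (f ` {n..}))"

lemma convex_blockD: "convex_block h f \<Longrightarrow> N \<le> n \<Longrightarrow> h n \<in> convex hull (f ` {N..})"
  unfolding convex_block_def by (meson atLeast_subset_iff hull_mono image_mono in_mono)

lemma convex_block_refl: "convex_block f f"
  unfolding convex_block_def by (auto intro: hull_inc)

lemma convex_block_trans:
  assumes "convex_block h g" "convex_block g f"
  shows "convex_block h f"
  unfolding convex_block_def
proof
  fix n
  have "convex hull (g ` {n..}) \<subseteq> convex hull (f ` {n..})"
    by (rule hull_minimal) (auto intro: convex_blockD[OF assms(2)])
  then show "h n \<in> convex hull (f ` {n..})"
    using convex_blockD[OF assms(1), of n n] by auto
qed

lemma convex_block_subseq:
  assumes "convex_block h f" "\<And>n. n \<le> \<phi> n"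
  shows "convex_block (\<lambda>n. h (\<phi> n)) f"
  unfolding convex_block_def using convex_blockD[OF assms(1)] assms(2) by blast

lemma convex_block_average:
  assumes "convex_block g f" "convex_block h f"
  shows "convex_block (\<lambda>n. (1 / 2) *\<^sub>R g n + (1 / 2) *\<^sub>R h n) f"
  unfolding convex_block_def
proof
  fix n
  show "(1 / 2) *\<^sub>R g n + (1 / 2) *\<^sub>R h n \<in> convex hull (f ` {n..})"
    by (rule convexD[OF convex_convex_hull]) (auto intro: convex_blockD assms)
qed

text \<open>Only from index \<open>k\<close> on are the diagonal terms taken from blocks of
  \<open>g k\<close>, hence the shift by \<open>k\<close>.\<close>

lemma convex_block_diagonal:
  assumes "\<And>k. convex_block (g (Suc k)) (g k)"
  shows "convex_block (\<lambda>n. g (n + k) (n + k)) (g k)"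
proof -
  have "convex_block (g (n + k)) (g k)" for n
    by (induction n) (auto intro: convex_block_refl convex_block_trans assms)
  from convex_blockD[OF this, of n "n + k" for n] show ?thesis
    by (simp add: convex_block_def)
qed

lemma convex_hull_le:
  fixes z :: "'a::real_normed_vector \<Rightarrow>\<^sub>L real"
  assumes "z \<in> convex hull S" "\<And>s. s \<in> S \<Longrightarrow> blinfun_apply s y \<le> c"
  shows "blinfun_apply z y \<le> c"
proof -
  have "convex {s :: 'a \<Rightarrow>\<^sub>L real. blinfun_apply s y \<le> c}"
    by (auto simp: convex_def blinfun.add_left blinfun.scaleR_left intro: convex_bound_le)
  then have "convex hull S \<subseteq> {s. blinfun_apply s y \<le> c}"
    using assms(2) by (intro hull_minimal) auto
  then show ?thesis using assms(1) by auto
qed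

lemma convex_hull_diff_le:
  fixes z :: "'a::real_normed_vector \<Rightarrow>\<^sub>L real"
  assumes "z \<in> convex hull S" "w \<in> convex hull S"
    and le: "\<And>s t. s \<in> S \<Longrightarrow> t \<in> S \<Longrightarrow> blinfun_apply s y - blinfun_apply t y \<le> c"
  shows "blinfun_apply z y - blinfun_apply w y \<le> c"
proof -
  have "blinfun_apply z y \<le> c + blinfun_apply t y" if "t \<in> S" for t
    by (rule convex_hull_le[OF assms(1)]) (use le that in \<open>force simp: algebra_simps\<close>)
  \<comment> \<open>Evaluation at \<open>- y\<close> turns a lower bound at \<open>y\<close> into an
    upper bound, so that \<open>convex_hull_le\<close> applies a second time.\<close>
  then have "blinfun_apply t (- y) \<le> c - blinfun_apply z y" if "t \<in> S" for t
    using that by (force simp: blinfun.minus_right)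
  then have "blinfun_apply w (- y) \<le> c - blinfun_apply z y"
    by (rule convex_hull_le[OF assms(2)])
  then show ?thesis by (simp add: blinfun.minus_right)
qed

lemma convex_block_norm_le:
  fixes f :: "nat \<Rightarrow> 'a::real_normed_vector"
  assumes "convex_block h f" "\<And>n. norm (f n) \<le> r"
  shows "norm (h n) \<le> r"
proof -
  have "convex hull (f ` {n..}) \<subseteq> cball 0 r"
    by (rule hull_minimal) (use assms(2) in auto)
  then show ?thesis using convex_blockD[OF assms(1), of n n] by auto
qed

lemma convex_block_tendsto:
  fixes f :: "nat \<Rightarrow> 'a::real_normed_vector \<Rightarrow>\<^sub>L real"
  assumes "convex_block h f" "(\<lambda>n. blinfun_apply (f n) y) \<longlonglongrightarrow> l"
  shows "(\<lambda>n. blinfun_apply (h n) y) \<longlonglongrightarrow> l"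
proof (rule LIMSEQ_I)
  fix e :: real assume "e > 0"
  then obtain N where N: "\<And>n. n \<ge> N \<Longrightarrow> norm (blinfun_apply (f n) y - l) < e / 2"
    using LIMSEQ_D[OF assms(2), of "e / 2"] by auto
  have "norm (blinfun_apply (h n) y - l) < e" if "n \<ge> N" for n
  proof -
    have h: "h n \<in> convex hull (f ` {N..})"
      using convex_blockD[OF assms(1) that] .
    have N': "blinfun_apply (f n) y \<le> l + e / 2" "blinfun_apply (f n) (- y) \<le> - l + e / 2" if "n \<ge> N" for n
      using N[OF that] unfolding real_norm_def blinfun.minus_right by linarith+
    have "blinfun_apply (h n) y \<le> l + e / 2"
      using h by (rule convex_hull_le) (use N'(1) in auto)
    moreover have "blinfun_apply (h n) (- y) \<le> - l + e / 2"
      using h by (rule convex_hull_le) (use N'(2) in auto)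
    ultimately show ?thesis
      using \<open>e > 0\<close> by (simp add: blinfun.minus_right)
  qed
  then show "\<exists>N. \<forall>n\<ge>N. norm (blinfun_apply (h n) y - l) < e" by blast
qed

text \<open>For bounded \<open>h\<close>, and apart from the boundary case, this says that at some
  point of \<open>C\<close> the limit superior of the values exceeds the limit inferior by more than
  \<open>d\<close>.\<close>

definition oscillates :: "(nat \<Rightarrow> 'a::real_normed_vector \<Rightarrow>\<^sub>L real) \<Rightarrow> 'a set \<Rightarrow> real \<Rightarrow> bool"
  where "oscillates h C d \<longleftrightarrow>
    (\<exists>y\<in>C. \<forall>N. \<exists>m\<ge>N. \<exists>n\<ge>N. d < blinfun_apply (h m) y - blinfun_apply (h n) y)"

text \<open>If the first case fails, successive blocks of blocks can be chosen to oscillate by at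
  most 1, 1/2, 1/3, ... at every point of \<open>C\<close>. Their diagonal is eventually a block of
  each, and convex hulls do not enlarge differences of values, so the diagonal is Cauchy on
  \<open>C\<close>.\<close>

lemma convex_block_dichotomy:
  fixes f :: "nat \<Rightarrow> 'a::real_normed_vector \<Rightarrow>\<^sub>L real"
  obtains g d where "convex_block g f" "d > 0" "\<And>h. convex_block h g \<Longrightarrow> oscillates h C d"
  | h where "convex_block h f" "\<And>y. y \<in> C \<Longrightarrow> Cauchy (\<lambda>n. blinfun_apply (h n) y)"
proof (cases "\<exists>g d. convex_block g f \<and> d > 0 \<and> (\<forall>h. convex_block h g \<longrightarrow> oscillates h C d)")
  case True
  then show thesis using that(1) by blast
next
  case False
  have "\<exists>g. \<forall>n. (convex_block (g n) f \<and> (n = 0 \<longrightarrow> g n = f)) \<and>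
      (convex_block (g (Suc n)) (g n) \<and> \<not> oscillates (g (Suc n)) C (1 / Suc n))"
  proof (rule dependent_nat_choice)
    fix g and n :: nat
    assume g: "convex_block g f \<and> (n = 0 \<longrightarrow> g = f)"
    have "(0::real) < 1 / Suc n" by simp
    then obtain h where "convex_block h g" "\<not> oscillates h C (1 / Suc n)"
      using False g by blast
    then show "\<exists>h. (convex_block h f \<and> (Suc n = 0 \<longrightarrow> h = f)) \<and>
        convex_block h g \<and> \<not> oscillates h C (1 / Suc n)"
      using g convex_block_trans by blast
  qed (auto intro: convex_block_refl)
  then obtain g where g0: "g 0 = f" and step: "\<And>n. convex_block (g (Suc n)) (g n)"
    and osc: "\<And>n. \<not> oscillates (g (Suc n)) C (1 / Suc n)"
    by blast
  define h where "h n = g n n" for n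
  have h: "convex_block (\<lambda>n. h (n + k)) (g k)" for k
    unfolding h_def by (rule convex_block_diagonal) (rule step)
  have "Cauchy (\<lambda>n. blinfun_apply (h n) y)" if "y \<in> C" for y
  proof (rule metric_CauchyI)
    fix e :: real assume "e > 0"
    then obtain k where k: "1 / Suc k < e"
      using nat_approx_posE by blast
    from osc[of k] \<open>y \<in> C\<close> obtain N where N: "\<forall>m\<ge>N. \<forall>n\<ge>N.
        blinfun_apply (g (Suc k) m) y - blinfun_apply (g (Suc k) n) y \<le> 1 / Suc k"
      unfolding oscillates_def not_less[symmetric] by blast
    have le: "blinfun_apply (h m) y - blinfun_apply (h n) y \<le> 1 / Suc k"
      if "m \<ge> N + Suc k" "n \<ge> N + Suc k" for m n
    proof (rule convex_hull_diff_le[where S = "g (Suc k) ` {N..}"])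
      show "h m \<in> convex hull (g (Suc k) ` {N..})" "h n \<in> convex hull (g (Suc k) ` {N..})"
        using convex_blockD[OF h[of "Suc k"], of N "m - Suc k"]
          convex_blockD[OF h[of "Suc k"], of N "n - Suc k"] that by simp_all
    qed (use N in auto)
    then have "dist (blinfun_apply (h m) y) (blinfun_apply (h n) y) < e"
      if "m \<ge> N + Suc k" "n \<ge> N + Suc k" for m n
      using le[OF that] le[OF that(2,1)] k by (simp add: dist_real_def)
    then show "\<exists>M. \<forall>m\<ge>M. \<forall>n\<ge>M. dist (blinfun_apply (h m) y) (blinfun_apply (h n) y) < e"
      by blast
  qed
  then show thesis
    using that(2)[of h] h[of 0] g0 by simp
qed

section \<open>Weak* compactness of the dual unit ball\<close>

lemma blinfun_abs_le_norm:
  fixes f :: "'a::real_normed_vector \<Rightarrow>\<^sub>L real"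
  assumes "norm f \<le> 1"
  shows "\<bar>blinfun_apply f y\<bar> \<le> norm y"
  using norm_blinfun[of f y] mult_right_mono[OF assms norm_ge_zero[of y]] by simp

lemma compact_box:
  assumes "\<And>i. compact (S i)"
  shows "compact {w :: 'i \<Rightarrow> 'a::topological_space. \<forall>i. w i \<in> S i}"
proof -
  have "compactin (product_topology (\<lambda>_. euclidean) UNIV) (PiE UNIV S)"
    by (subst compactin_PiE) (simp add: assms)
  moreover have "PiE UNIV S = {w. \<forall>i. w i \<in> S i}" by auto
  ultimately show ?thesis by (simp add: euclidean_product_topology)
qed

text \<open>Banach-Alaoglu for all indices \<open>i\<close> at once: the values lie in a product of
  intervals over the pairs \<open>(i, z)\<close>. The product is uncountable in general, so a
  cluster point replaces a convergent subsequence; closed conditions that hold eventually, linearity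
  among them, pass to it.\<close>

lemma weak_star_cluster:
  fixes F :: "nat \<Rightarrow> nat \<Rightarrow> 'a::real_normed_vector \<Rightarrow>\<^sub>L real"
  assumes F: "\<And>k i. norm (F k i) \<le> 1"
  obtains f where "\<And>i. norm (f i) \<le> 1"
    and "\<And>A. closed A \<Longrightarrow> \<forall>\<^sub>F k in sequentially. (\<lambda>(i, z). blinfun_apply (F k i) z) \<in> A \<Longrightarrow>
      (\<lambda>(i, z). blinfun_apply (f i) z) \<in> A"
proof -
  define W where "W k = (\<lambda>(i, z). blinfun_apply (F k i) z)" for k
  define box where "box = {w :: nat \<times> 'a \<Rightarrow> real. \<forall>p. w p \<in> {- norm (snd p)..norm (snd p)}}"
  have "\<bar>blinfun_apply (F k i) z\<bar> \<le> norm z" for k i z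
    using F by (rule blinfun_abs_le_norm)
  then have box: "W k \<in> box" for k
    by (auto simp: W_def box_def abs_le_iff minus_le_iff split_beta)
  have "compact box"
    unfolding box_def by (rule compact_box) simp
  moreover have "\<forall>\<^sub>F w in filtermap W sequentially. w \<in> box"
    using box by (simp add: eventually_filtermap)
  moreover have "filtermap W sequentially \<noteq> bot"
    by (simp add: filtermap_bot_iff)
  ultimately obtain w where w: "w \<in> box" "inf (nhds w) (filtermap W sequentially) \<noteq> bot"
    unfolding compact_filter by blast
  have cluster: "w \<in> A" if A: "closed A" "\<forall>\<^sub>F k in sequentially. W k \<in> A" for A
  proof (rule ccontr)
    assume "w \<notin> A"
    then have "\<forall>\<^sub>F v in nhds w. v \<in> - A"
      using A(1) by (intro eventually_nhds_in_open) auto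
    moreover have "\<forall>\<^sub>F v in filtermap W sequentially. v \<in> A"
      using A(2) by (simp add: eventually_filtermap)
    ultimately have "\<forall>\<^sub>F v in inf (nhds w) (filtermap W sequentially). False"
      unfolding eventually_inf by (intro exI[of _ "\<lambda>v. v \<in> - A"] exI[of _ "\<lambda>v. v \<in> A"]) auto
    then show False using w(2) by (simp add: eventually_False)
  qed
  have cont: "continuous_on UNIV (\<lambda>v :: nat \<times> 'a \<Rightarrow> real. v p)" for p
    by simp
  have add: "w (i, x + y) = w (i, x) + w (i, y)" for i x y
  proof -
    have "w \<in> {v. v (i, x + y) = v (i, x) + v (i, y)}"
    proof (rule cluster)
      show "closed {v :: nat \<times> 'a \<Rightarrow> real. v (i, x + y) = v (i, x) + v (i, y)}"
        by (intro closed_Collect_eq continuous_on_add continuous_on_mult_left cont)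
    qed (simp add: W_def blinfun.add_right)
    then show ?thesis by simp
  qed
  have scale: "w (i, r *\<^sub>R x) = r * w (i, x)" for i r x
  proof -
    have "w \<in> {v. v (i, r *\<^sub>R x) = r * v (i, x)}"
    proof (rule cluster)
      show "closed {v :: nat \<times> 'a \<Rightarrow> real. v (i, r *\<^sub>R x) = r * v (i, x)}"
        by (intro closed_Collect_eq continuous_on_add continuous_on_mult_left cont)
    qed (simp add: W_def blinfun.scaleR_right)
    then show ?thesis by simp
  qed
  have bound: "\<bar>w (i, x)\<bar> \<le> norm x" for i x
    using w(1) unfolding box_def by (auto simp: abs_le_iff minus_le_iff dest!: spec[of _ "(i, x)"])
  define f where "f i = Blinfun (\<lambda>x. w (i, x))" for i
  have "bounded_linear (\<lambda>x. w (i, x))" for i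
    by (rule bounded_linear_intro[where K = 1]) (simp_all add: add scale bound)
  then have app: "blinfun_apply (f i) x = w (i, x)" for i x
    unfolding f_def by (simp add: bounded_linear_Blinfun_apply)
  have "norm (f i) \<le> 1" for i
    by (rule norm_blinfun_bound) (simp_all add: app bound)
  moreover have "(\<lambda>(i, z). blinfun_apply (f i) z) = w"
    by (auto simp: app)
  ultimately show thesis
    using that[of f] cluster by (simp add: W_def)
qed

subsection \<open>Weak* null sequences from oscillation\<close>

text \<open>For every \<open>k\<close> a finite construction gives \<open>k\<close> functionals with
  Bessel's inequality and large values at points of \<open>C\<close>. Both conditions are closed and
  the points do not change with \<open>k\<close>, so a weak* cluster point satisfies them for all
  indices; Bessel's inequality then makes the squares of its values summable.\<close>

lemma weak_star_null_of_oscillation: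
  fixes g :: "nat \<Rightarrow> 'a::real_normed_vector \<Rightarrow>\<^sub>L real"
  assumes norm: "\<And>n. norm (g n) \<le> 1"
    and osc: "\<And>h. convex_block h g \<Longrightarrow> oscillates h C d"
  obtains f y where "\<And>i. norm (f i) \<le> 1" "\<And>i. y i \<in> C" "\<And>i. d / 2 \<le> blinfun_apply (f i) (y i)"
    and "\<And>z. (\<lambda>i. blinfun_apply (f i) z) \<longlonglongrightarrow> 0"
proof -
  \<comment> \<open>At stage \<open>k\<close> there is a sequence indexed by \<open>j\<close> of vectors \<open>(c j, \<psi> j 0, \<dots>, \<psi> j (k - 1))\<close> obeying Bessel's
      inequality. The next stage picks pairs \<open>(m, n)\<close> along which \<open>c\<close> oscillates at some point and replaces
      \<open>c m, c n\<close> by their average and half difference, the latter being the new \<open>\<psi>\<close>; the parallelogram law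
      preserves the inequality.\<close>
  define P :: "nat \<Rightarrow> (nat \<Rightarrow> 'a \<Rightarrow>\<^sub>L real) \<times> (nat \<Rightarrow> nat \<Rightarrow> 'a \<Rightarrow>\<^sub>L real) \<times> (nat \<Rightarrow> 'a) \<Rightarrow> bool"
    where "P k = (\<lambda>(c, \<psi>, y). convex_block c g \<and>
      (\<forall>i<k. y i \<in> C \<and> (\<forall>j. d / 2 \<le> blinfun_apply (\<psi> j i) (y i))) \<and>
      (\<forall>j z. (blinfun_apply (c j) z)\<^sup>2 + (\<Sum>i<k. (blinfun_apply (\<psi> j i) z)\<^sup>2) \<le> (norm z)\<^sup>2))" for k
  have "\<exists>s. \<forall>k. P k (s k) \<and> (\<forall>i<k. snd (snd (s (Suc k))) i = snd (snd (s k)) i)"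
  proof (rule dependent_nat_choice)
    have "(blinfun_apply (g j) z)\<^sup>2 \<le> (norm z)\<^sup>2" for j z
      using blinfun_abs_le_norm[OF norm] by (intro abs_le_square_iff[THEN iffD1]) simp
    then show "\<exists>s. P 0 s"
      by (intro exI[of _ "(g, \<lambda>_ _. 0, \<lambda>_. 0)"]) (simp add: P_def convex_block_refl)
  next
    fix s k
    assume "P k s"
    then obtain c \<psi> y where s: "s = (c, \<psi>, y)" and c: "convex_block c g"
      and y: "\<And>i. i < k \<Longrightarrow> y i \<in> C" "\<And>i j. i < k \<Longrightarrow> d / 2 \<le> blinfun_apply (\<psi> j i) (y i)"
      and bessel: "\<And>j z. (blinfun_apply (c j) z)\<^sup>2 + (\<Sum>i<k. (blinfun_apply (\<psi> j i) z)\<^sup>2) \<le> (norm z)\<^sup>2"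
      by (cases s) (simp add: P_def)
    obtain y' where y': "y' \<in> C" "\<forall>N. \<exists>m\<ge>N. \<exists>n\<ge>N. d < blinfun_apply (c m) y' - blinfun_apply (c n) y'"
      using osc[OF c] unfolding oscillates_def by blast
    then obtain a b where ab: "\<And>N. N \<le> a N" "\<And>N. N \<le> b N"
      "\<And>N. d < blinfun_apply (c (a N)) y' - blinfun_apply (c (b N)) y'"
      by metis
    define c' where "c' j = (1 / 2) *\<^sub>R c (a j) + (1 / 2) *\<^sub>R c (b j)" for j
    define \<psi>' where "\<psi>' j i = (if i < k then (1 / 2) *\<^sub>R \<psi> (a j) i + (1 / 2) *\<^sub>R \<psi> (b j) i
      else (1 / 2) *\<^sub>R c (a j) - (1 / 2) *\<^sub>R c (b j))" for j i
    have "convex_block c' g"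
      unfolding c'_def by (intro convex_block_average convex_block_subseq[OF c] ab)
    moreover have "(y(k := y')) i \<in> C \<and> (\<forall>j. d / 2 \<le> blinfun_apply (\<psi>' j i) ((y(k := y')) i))"
      if "i < Suc k" for i
    proof (cases "i < k")
      case True
      then have "d / 2 \<le> blinfun_apply (\<psi>' j i) (y i)" for j
        using y(2)[of i "a j"] y(2)[of i "b j"]
        by (simp add: \<psi>'_def blinfun.add_left blinfun.scaleR_left)
      then show ?thesis using True y(1) by simp
    next
      case False
      have "d / 2 \<le> blinfun_apply (\<psi>' j k) y'" for j
        using ab(3)[of j] by (simp add: \<psi>'_def blinfun.diff_left blinfun.scaleR_left)
      moreover have "i = k" using False that by simp
      ultimately show ?thesis using y'(1) by simp
    qed
    moreover have "(blinfun_apply (c' j) z)\<^sup>2 + (\<Sum>i<Suc k. (blinfun_apply (\<psi>' j i) z)\<^sup>2) \<le> (norm z)\<^sup>2"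
      for j z
    proof -
      define u where "u = blinfun_apply (c (a j)) z"
      define v where "v = blinfun_apply (c (b j)) z"
      define p where "p i = blinfun_apply (\<psi> (a j) i) z" for i
      define q where "q i = blinfun_apply (\<psi> (b j) i) z" for i
      have "(\<Sum>i<k. (blinfun_apply (\<psi>' j i) z)\<^sup>2) = (\<Sum>i<k. (p i / 2 + q i / 2)\<^sup>2)"
        by (intro sum.cong) (simp_all add: \<psi>'_def p_def q_def blinfun.add_left blinfun.scaleR_left)
      also have "\<dots> \<le> (\<Sum>i<k. (p i)\<^sup>2 / 2 + (q i)\<^sup>2 / 2)"
      proof (rule sum_mono)
        fix i
        have "(p i)\<^sup>2 / 2 + (q i)\<^sup>2 / 2 - (p i / 2 + q i / 2)\<^sup>2 = ((p i - q i) / 2)\<^sup>2"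
          by (simp add: power2_eq_square field_simps)
        then show "(p i / 2 + q i / 2)\<^sup>2 \<le> (p i)\<^sup>2 / 2 + (q i)\<^sup>2 / 2"
          by (smt (verit) zero_le_power2)
      qed
      also have "\<dots> = (\<Sum>i<k. (p i)\<^sup>2) / 2 + (\<Sum>i<k. (q i)\<^sup>2) / 2"
        by (simp add: sum.distrib sum_divide_distrib)
      finally have "(\<Sum>i<k. (blinfun_apply (\<psi>' j i) z)\<^sup>2) \<le> (\<Sum>i<k. (p i)\<^sup>2) / 2 + (\<Sum>i<k. (q i)\<^sup>2) / 2" .
      moreover have "(blinfun_apply (c' j) z)\<^sup>2 + (blinfun_apply (\<psi>' j k) z)\<^sup>2 = u\<^sup>2 / 2 + v\<^sup>2 / 2"
        by (simp add: c'_def \<psi>'_def u_def v_def blinfun.add_left blinfun.diff_left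
            blinfun.scaleR_left power2_eq_square field_simps)
      moreover have "u\<^sup>2 + (\<Sum>i<k. (p i)\<^sup>2) \<le> (norm z)\<^sup>2" "v\<^sup>2 + (\<Sum>i<k. (q i)\<^sup>2) \<le> (norm z)\<^sup>2"
        unfolding u_def v_def p_def q_def by (rule bessel)+
      ultimately show ?thesis by simp
    qed
    ultimately have "P (Suc k) (c', \<psi>', y(k := y'))"
      by (simp add: P_def)
    then show "\<exists>t. P (Suc k) t \<and> (\<forall>i<k. snd (snd t) i = snd (snd s) i)"
      by (intro exI[of _ "(c', \<psi>', y(k := y'))"]) (simp add: s)
  qed
  then obtain s where s: "\<And>k. P k (s k)"
    and same: "\<And>k i. i < k \<Longrightarrow> snd (snd (s (Suc k))) i = snd (snd (s k)) i"
    by blast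
  define Y where "Y i = snd (snd (s (Suc i))) i" for i
  have Y: "snd (snd (s k)) i = Y i" if "i < k" for i k
    using that
  proof (induction k)
    case (Suc k)
    then show ?case using same[of i k] by (cases "i = k") (auto simp: Y_def)
  qed simp
  \<comment> \<open>Stage \<open>k\<close> contributes its vector with \<open>j = 0\<close>. The
    padding zeros respect the norm bound, and for each \<open>i\<close> they occur only at the
    stages \<open>k <= i\<close>, which a cluster point ignores.\<close>
  define F where "F k i = (if i < k then fst (snd (s k)) 0 i else 0)" for k i
  have YC: "Y i \<in> C" for i
    using s[of "Suc i"] by (simp add: P_def split_beta Y)
  have FY: "d / 2 \<le> blinfun_apply (F k i) (Y i)" if "i < k" for i k
    using s[of k] that by (simp add: P_def F_def split_beta Y)
  have bessel: "(\<Sum>i<N. (blinfun_apply (F k i) z)\<^sup>2) \<le> (norm z)\<^sup>2" for N k z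
  proof -
    have "(\<Sum>i<N. (blinfun_apply (F k i) z)\<^sup>2) = (\<Sum>i\<in>{..<N} \<inter> {..<k}. (blinfun_apply (F k i) z)\<^sup>2)"
      by (rule sum.mono_neutral_right) (auto simp: F_def)
    also have "\<dots> \<le> (\<Sum>i<k. (blinfun_apply (F k i) z)\<^sup>2)"
      by (rule sum_mono2) auto
    also have "\<dots> = (\<Sum>i<k. (blinfun_apply (fst (snd (s k)) 0 i) z)\<^sup>2)"
      by (intro sum.cong) (auto simp: F_def)
    also have "\<dots> \<le> (norm z)\<^sup>2"
    proof -
      have "(blinfun_apply (fst (s k) 0) z)\<^sup>2 + (\<Sum>i<k. (blinfun_apply (fst (snd (s k)) 0 i) z)\<^sup>2)
          \<le> (norm z)\<^sup>2"
        using s[of k] by (simp add: P_def split_beta)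
      then show ?thesis
        using zero_le_power2[of "blinfun_apply (fst (s k) 0) z"] by linarith
    qed
    finally show ?thesis .
  qed
  have "norm (F k i) \<le> 1" for k i
  proof (rule norm_blinfun_bound)
    fix z
    have "(blinfun_apply (F k i) z)\<^sup>2 \<le> (\<Sum>i<Suc i. (blinfun_apply (F k i) z)\<^sup>2)"
      by (simp add: sum_nonneg)
    also have "\<dots> \<le> (norm z)\<^sup>2" by (rule bessel)
    finally show "norm (blinfun_apply (F k i) z) \<le> 1 * norm z"
      using abs_le_square_iff[of "blinfun_apply (F k i) z" "norm z"] by simp
  qed simp
  from this obtain f where f: "\<And>i. norm (f i) \<le> 1"
    and cluster: "\<And>A. closed A \<Longrightarrow> \<forall>\<^sub>F k in sequentially. (\<lambda>(i, z). blinfun_apply (F k i) z) \<in> A \<Longrightarrow>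
      (\<lambda>(i, z). blinfun_apply (f i) z) \<in> A"
    by (rule weak_star_cluster[of F]) blast
  have cont: "continuous_on UNIV (\<lambda>v :: nat \<times> 'a \<Rightarrow> real. v p)" for p
    by simp
  have fY: "d / 2 \<le> blinfun_apply (f i) (Y i)" for i
  proof -
    have "(\<lambda>(i, z). blinfun_apply (f i) z) \<in> {v. d / 2 \<le> v (i, Y i)}"
    proof (rule cluster)
      show "closed {v :: nat \<times> 'a \<Rightarrow> real. d / 2 \<le> v (i, Y i)}"
        by (intro closed_Collect_le continuous_on_const cont)
      show "\<forall>\<^sub>F k in sequentially. (\<lambda>(i, z). blinfun_apply (F k i) z) \<in> {v. d / 2 \<le> v (i, Y i)}"
        using eventually_gt_at_top[of i] by eventually_elim (use FY[of i] in simp)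
    qed
    then show ?thesis by simp
  qed
  have sum_le: "(\<Sum>i<N. (blinfun_apply (f i) z)\<^sup>2) \<le> (norm z)\<^sup>2" for N z
  proof -
    have "(\<lambda>(i, z). blinfun_apply (f i) z) \<in> {v. (\<Sum>i<N. (v (i, z))\<^sup>2) \<le> (norm z)\<^sup>2}"
    proof (rule cluster)
      show "closed {v :: nat \<times> 'a \<Rightarrow> real. (\<Sum>i<N. (v (i, z))\<^sup>2) \<le> (norm z)\<^sup>2}"
        by (intro closed_Collect_le continuous_on_const continuous_on_sum continuous_on_power cont)
    qed (simp add: bessel)
    then show ?thesis by simp
  qed
  have "(\<lambda>i. blinfun_apply (f i) z) \<longlonglongrightarrow> 0" for z
  proof -
    have "summable (\<lambda>i. (blinfun_apply (f i) z)\<^sup>2)"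
      by (rule summableI_nonneg_bounded[OF _ sum_le]) simp
    then have "(\<lambda>i. (blinfun_apply (f i) z)\<^sup>2) \<longlonglongrightarrow> 0"
      by (rule summable_LIMSEQ_zero)
    then have "(\<lambda>i. sqrt ((blinfun_apply (f i) z)\<^sup>2)) \<longlonglongrightarrow> sqrt 0"
      by (rule tendsto_real_sqrt)
    then show ?thesis by (simp add: tendsto_rabs_zero_iff)
  qed
  then show thesis using that f YC fY by blast
qed

subsection \<open>Schauder's theorem and countable norming sets\<close>

text \<open>Greedy recursion with the earlier terms as \<open>A\<close>. With \<open>R\<close>
  expressing separation, the absence of finite nets yields an infinite separated sequence.\<close>

lemma separated_sequence:
  assumes "\<And>A. finite A \<Longrightarrow> A \<subseteq> S \<Longrightarrow> \<exists>x\<in>S. \<forall>a\<in>A. R a x"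
  shows "\<exists>s :: nat \<Rightarrow> 'a. (\<forall>n. s n \<in> S) \<and> (\<forall>m n. m < n \<longrightarrow> R (s m) (s n))"
proof -
  have "\<exists>s. \<forall>n::nat. s n \<in> S \<and> (\<forall>m<n. R (s m) (s n))"
  proof (rule dependent_wellorder_choice)
    fix n :: nat and s :: "nat \<Rightarrow> 'a"
    assume "\<And>m. m < n \<Longrightarrow> s m \<in> S \<and> (\<forall>l<m. R (s l) (s m))"
    then have "s ` {..<n} \<subseteq> S" by auto
    then obtain x where "x \<in> S" "\<forall>a\<in>s ` {..<n}. R a x"
      using assms[of "s ` {..<n}"] by blast
    then show "\<exists>x. x \<in> S \<and> (\<forall>m<n. R (s m) x)"
      by (intro exI[of _ x]) simp
  qed simp
  then show ?thesis by blast
qed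

text \<open>A countable product of compact intervals is compact and first countable, hence
  sequentially compact; this stands in for an explicit diagonal argument.\<close>

lemma common_convergent_subsequence:
  fixes a :: "nat \<Rightarrow> nat \<Rightarrow> real"
  assumes "\<And>n i. \<bar>a n i\<bar> \<le> B i"
  obtains r where "strict_mono r" "\<And>i. convergent (\<lambda>n. a (r n) i)"
proof -
  have "compact {w :: nat \<Rightarrow> real. \<forall>i. w i \<in> {- B i..B i}}"
    by (rule compact_box) simp
  then have "seq_compact {w :: nat \<Rightarrow> real. \<forall>i. w i \<in> {- B i..B i}}"
    by (rule compact_imp_seq_compact)
  moreover have "a n \<in> {w. \<forall>i. w i \<in> {- B i..B i}}" for n
    using assms[of n] by (auto simp: abs_le_iff minus_le_iff)
  ultimately obtain l r where r: "strict_mono r" "(a \<circ> r) \<longlonglongrightarrow> l"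
    unfolding seq_compact_def by blast
  have "(\<lambda>n. a (r n) i) \<longlonglongrightarrow> l i" for i
    using continuous_on_tendsto_compose[OF continuous_on_product_coordinates[of i] r(2)]
    by (simp add: o_def)
  then show thesis using that r(1) convergentI by blast
qed

text \<open>One half of Schauder's theorem. If the dual ball had a finite \<open>e / 4\<close>-net
  \<open>A\<close> for the supremum over \<open>C\<close>, then among \<open>e\<close>-separated
  points of \<open>C\<close> two would be nearly indistinguishable for \<open>A\<close>, hence also
  for a functional norming their difference.\<close>

lemma separated_functionals:
  fixes C :: "'a::real_normed_vector set"
  assumes "bounded C" "\<not> totally_bounded C"
  obtains f :: "nat \<Rightarrow> 'a \<Rightarrow>\<^sub>L real" and d where "d > 0" "\<And>n. norm (f n) \<le> 1"
    and "\<forall>m n. m < n \<longrightarrow> (\<exists>y\<in>C. d < \<bar>blinfun_apply (f m) y - blinfun_apply (f n) y\<bar>)"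
proof -
  obtain e where e: "e > 0" "\<And>K. finite K \<Longrightarrow> \<not> C \<subseteq> (\<Union>x\<in>K. {y. dist x y < e})"
    using assms(2) unfolding totally_bounded_metric by blast
  have "\<exists>y :: nat \<Rightarrow> 'a. (\<forall>n. y n \<in> C) \<and> (\<forall>m n. m < n \<longrightarrow> e \<le> dist (y m) (y n))"
  proof (rule separated_sequence[of C "\<lambda>a x. e \<le> dist a x"])
    fix A assume "finite A" "A \<subseteq> C"
    then obtain x where "x \<in> C" "x \<notin> (\<Union>x\<in>A. {y. dist x y < e})"
      using e(2)[OF \<open>finite A\<close>] by blast
    then show "\<exists>x\<in>C. \<forall>a\<in>A. e \<le> dist a x"
      by (intro bexI[of _ x]) (auto simp: not_less)
  qed
  then obtain y :: "nat \<Rightarrow> 'a" where y: "\<And>n. y n \<in> C" "\<And>m n. m < n \<Longrightarrow> e \<le> dist (y m) (y n)"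
    by blast
  obtain B where B: "\<And>x. x \<in> C \<Longrightarrow> norm x \<le> B"
    using assms(1) unfolding bounded_iff by blast
  have "\<exists>f :: nat \<Rightarrow> 'a \<Rightarrow>\<^sub>L real. (\<forall>n. f n \<in> {f. norm f \<le> 1}) \<and>
    (\<forall>m n. m < n \<longrightarrow> (\<exists>y\<in>C. e / 4 < \<bar>blinfun_apply (f m) y - blinfun_apply (f n) y\<bar>))"
  proof (rule separated_sequence[of "{f :: 'a \<Rightarrow>\<^sub>L real. norm f \<le> 1}"
        "\<lambda>a f. \<exists>y\<in>C. e / 4 < \<bar>blinfun_apply a y - blinfun_apply f y\<bar>"])
    fix A :: "('a \<Rightarrow>\<^sub>L real) set" assume A: "finite A" "A \<subseteq> {f. norm f \<le> 1}"
    show "\<exists>f\<in>{f. norm f \<le> 1}. \<forall>a\<in>A. \<exists>y\<in>C. e / 4 < \<bar>blinfun_apply a y - blinfun_apply f y\<bar>"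
    proof (rule ccontr)
      assume "\<not> ?thesis"
      then have near: "\<exists>a\<in>A. \<forall>y\<in>C. \<bar>blinfun_apply a y - blinfun_apply f y\<bar> \<le> e / 4"
        if "norm f \<le> 1" for f
        using that by (force simp: not_less)
      obtain xs where xs: "set xs = A" using finite_list[OF A(1)] by blast
      \<comment> \<open>The finite list is padded with zeros to a sequence of coordinates, as
        \<open>common_convergent_subsequence\<close> expects.\<close>
      define a where "a n i = (if i < length xs then blinfun_apply (xs ! i) (y n) else 0)" for n i
      have "B \<ge> 0" using B[OF y(1)[of 0]] norm_ge_zero order_trans by blast
      have "\<bar>a n i\<bar> \<le> B" for n i
      proof (cases "i < length xs")
        case True
        then have "norm (xs ! i) \<le> 1" using A(2) xs nth_mem by blast
        then show ?thesis
          using blinfun_abs_le_norm[of "xs ! i" "y n"] B[OF y(1)[of n]] True by (simp add: a_def)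
      qed (simp add: a_def \<open>B \<ge> 0\<close>)
      then obtain r where r: "strict_mono r" "\<And>i. convergent (\<lambda>n. a (r n) i)"
        by (rule common_convergent_subsequence[of a "\<lambda>_. B"]) blast
      have "\<exists>N. \<forall>n\<ge>N. dist (a (r n) i) (a (r (Suc n)) i) < e / 4" for i
      proof -
        obtain N where "\<forall>m\<ge>N. \<forall>n\<ge>N. dist (a (r m) i) (a (r n) i) < e / 4"
          using metric_CauchyD[OF convergent_Cauchy[OF r(2)[of i]], of "e / 4"] \<open>e > 0\<close> by auto
        then show ?thesis by (meson le_SucI)
      qed
      then have "\<forall>\<^sub>F n in sequentially. dist (a (r n) i) (a (r (Suc n)) i) < e / 4" for i
        by (simp add: eventually_sequentially)
      then have "\<forall>\<^sub>F n in sequentially. \<forall>i\<in>{..<length xs}. dist (a (r n) i) (a (r (Suc n)) i) < e / 4"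
        by (intro eventually_ball_finite) auto
      then obtain n where n: "\<And>i. i < length xs \<Longrightarrow> dist (a (r n) i) (a (r (Suc n)) i) < e / 4"
        unfolding eventually_sequentially by blast
      define u where "u = y (r n)"
      define v where "v = y (r (Suc n))"
      have uv: "u \<in> C" "v \<in> C" "e \<le> norm (u - v)"
        using y strict_monoD[OF r(1), of n "Suc n"] by (auto simp: u_def v_def dist_norm)
      have small: "\<bar>blinfun_apply g u - blinfun_apply g v\<bar> < e / 4" if "g \<in> A" for g
        using that n unfolding xs[symmetric] in_set_conv_nth
        by (auto simp: a_def u_def v_def dist_real_def)
      obtain f :: "'a \<Rightarrow>\<^sub>L real" where f: "norm f \<le> 1" "blinfun_apply f (u - v) = norm (u - v)"
        by (rule norming_functional)
      obtain g where g: "g \<in> A" "\<And>y. y \<in> C \<Longrightarrow> \<bar>blinfun_apply g y - blinfun_apply f y\<bar> \<le> e / 4"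
        using near[OF f(1)] by blast
      have "blinfun_apply f u - blinfun_apply f v = norm (u - v)"
        using f(2) by (simp add: blinfun.diff_right)
      \<comment> \<open>Two replacements of \<open>f\<close> by \<open>g\<close> and the gap of
        \<open>g\<close> cost less than \<open>3 * e / 4\<close>, while the points are at least
        \<open>e\<close> apart.\<close>
      then show False
        using g(2)[OF uv(1)] g(2)[OF uv(2)] small[OF g(1)] uv(3) \<open>e > 0\<close> by linarith
    qed
  qed
  then obtain f :: "nat \<Rightarrow> 'a \<Rightarrow>\<^sub>L real" where "\<And>n. norm (f n) \<le> 1"
    "\<forall>m n. m < n \<longrightarrow> (\<exists>y\<in>C. e / 4 < \<bar>blinfun_apply (f m) y - blinfun_apply (f n) y\<bar>)"
    by blast
  then show thesis using that[of "e / 4" f] e(1) by simp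
qed

text \<open>Lists of pairs form a countable type, so these combinations can be enumerated in
  \<open>half_norming_sequence\<close>.\<close>

lemma rational_combinations_dense:
  fixes f :: "nat \<Rightarrow> 'a::real_normed_vector"
  assumes "w \<in> span (range f)" "e > 0"
  shows "\<exists>l :: (rat \<times> nat) list. norm (w - (\<Sum>(q, i)\<leftarrow>l. of_rat q *\<^sub>R f i)) < e"
  using assms
proof (induction arbitrary: e rule: span_induct_alt)
  case base
  then show ?case by (intro exI[of _ "[]"]) simp
next
  case (step c x v)
  obtain l :: "(rat \<times> nat) list" where l: "norm (v - (\<Sum>(q, i)\<leftarrow>l. of_rat q *\<^sub>R f i)) < e / 2"
    using step.IH[of "e / 2"] step.prems by auto
  obtain i where i: "x = f i" using step.hyps(1) by blast
  define \<delta> where "\<delta> = e / (2 * (norm x + 1))"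
  have pos: "\<delta> > 0" using step.prems by (simp add: \<delta>_def add_nonneg_pos)
  then obtain q where q: "c - \<delta> < of_rat q" "of_rat q < c"
    using of_rat_dense[of "c - \<delta>" c] by auto
  have "norm (c *\<^sub>R x - of_rat q *\<^sub>R f i) = \<bar>c - of_rat q\<bar> * norm x"
    by (simp add: i flip: scaleR_diff_left)
  also have "\<dots> \<le> \<delta> * norm x"
    using q by (intro mult_right_mono) auto
  also have "\<dots> \<le> \<delta> * (norm x + 1)"
    using pos by (intro mult_left_mono) auto
  also have "\<dots> = e / 2"
    unfolding \<delta>_def using add_nonneg_pos[OF norm_ge_zero[of x] zero_less_one]
    by (simp add: divide_simps)
  finally have "norm (c *\<^sub>R x - of_rat q *\<^sub>R f i) \<le> e / 2" .
  then have "norm ((c *\<^sub>R x - of_rat q *\<^sub>R f i) + (v - (\<Sum>(q, i)\<leftarrow>l. of_rat q *\<^sub>R f i))) < e"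
    using l norm_triangle_ineq[of "c *\<^sub>R x - of_rat q *\<^sub>R f i" "v - (\<Sum>(q, i)\<leftarrow>l. of_rat q *\<^sub>R f i)"]
    by linarith
  then show ?case
    by (intro exI[of _ "(q, i) # l"]) (simp add: algebra_simps)
qed

text \<open>The supremum over \<open>C\<close> may not be attained, whence the factor 2; if it is
  not positive, \<open>w\<close> vanishes on \<open>C\<close> and any point will do.\<close>

lemma half_norming_point:
  fixes w :: "'a::real_normed_vector \<Rightarrow>\<^sub>L real"
  assumes "bounded C" "C \<noteq> {}"
  shows "\<exists>x\<in>C. \<forall>y\<in>C. \<bar>blinfun_apply w y\<bar> \<le> 2 * \<bar>blinfun_apply w x\<bar>"
proof -
  have "bounded (blinfun_apply w ` C)"
    using assms(1) by (rule bounded_linear_image) (rule blinfun.bounded_linear_right)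
  then obtain b where "\<And>y. y \<in> C \<Longrightarrow> \<bar>blinfun_apply w y\<bar> \<le> b"
    unfolding bounded_iff by auto
  then have bdd: "bdd_above ((\<lambda>y. \<bar>blinfun_apply w y\<bar>) ` C)"
    by (intro bdd_aboveI2[where M = b])
  define s where "s = (SUP y\<in>C. \<bar>blinfun_apply w y\<bar>)"
  have le: "\<bar>blinfun_apply w y\<bar> \<le> s" if "y \<in> C" for y
    unfolding s_def using that bdd by (rule cSUP_upper)
  show ?thesis
  proof (cases "s > 0")
    case True
    then obtain x where "x \<in> C" "s / 2 < \<bar>blinfun_apply w x\<bar>"
      using less_cSUP_iff[OF assms(2) bdd, of "s / 2"] unfolding s_def by auto
    then show ?thesis using le by (intro bexI[of _ x]) force+
  next
    case False
    then show ?thesis using le assms(2) by force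
  qed
qed

text \<open>One half-norming point for each rational combination of the \<open>f i\<close> suffices,
  since these combinations approximate every \<open>w\<close> in the span uniformly on the bounded
  set \<open>C\<close>.\<close>

lemma half_norming_sequence:
  fixes f :: "nat \<Rightarrow> 'a::real_normed_vector \<Rightarrow>\<^sub>L real"
  assumes "bounded C" "C \<noteq> {}"
  obtains x :: "nat \<Rightarrow> 'a" where "\<And>k. x k \<in> C"
    and "\<forall>w\<in>span (range f). \<forall>c. (\<forall>k. \<bar>blinfun_apply w (x k)\<bar> \<le> c) \<longrightarrow>
      (\<forall>y\<in>C. \<bar>blinfun_apply w y\<bar> \<le> 2 * c)"
proof -
  obtain B where B: "\<And>x. x \<in> C \<Longrightarrow> norm x \<le> B"
    using assms(1) unfolding bounded_iff by blast
  obtain p where p: "\<And>w :: 'a \<Rightarrow>\<^sub>L real. p w \<in> C"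
    "\<And>w y. y \<in> C \<Longrightarrow> \<bar>blinfun_apply w y\<bar> \<le> 2 * \<bar>blinfun_apply w (p w)\<bar>"
    using half_norming_point[OF assms] by metis
  define comb where "comb l = (\<Sum>(q, i)\<leftarrow>l. of_rat q *\<^sub>R f i)" for l :: "(rat \<times> nat) list"
  define x where "x k = p (comb (from_nat k))" for k
  show thesis
  proof (rule that; (intro ballI allI impI)?)
    show "x k \<in> C" for k unfolding x_def by (rule p)
  next
    fix w c y
    assume w: "w \<in> span (range f)" "\<forall>k. \<bar>blinfun_apply w (x k)\<bar> \<le> c" and y: "y \<in> C"
    have "\<bar>blinfun_apply w y\<bar> \<le> 2 * c + e" if "e > 0" for e
    proof -
      have B0: "B \<ge> 0" using B[OF y] norm_ge_zero order_trans by blast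
      \<comment> \<open>The approximation error enters once at \<open>y\<close> and, doubled, at the
        norming point: three times in all.\<close>
      define \<delta> where "\<delta> = e / (3 * (B + 1))"
      have \<delta>: "\<delta> > 0" "\<delta> * B \<le> e / 3"
        using B0 that by (auto simp: \<delta>_def field_simps)
      obtain l where l: "norm (w - comb l) < \<delta>"
        using rational_combinations_dense[OF w(1) \<delta>(1)] unfolding comb_def by blast
      have diff: "\<bar>blinfun_apply w z - blinfun_apply (comb l) z\<bar> \<le> e / 3" if "z \<in> C" for z
      proof -
        have "\<bar>blinfun_apply (w - comb l) z\<bar> \<le> norm (w - comb l) * norm z"
          using norm_blinfun[of "w - comb l" z] by simp
        also have "\<dots> \<le> \<delta> * B"
          using l B[OF that] \<delta>(1) by (intro mult_mono) auto
        finally show ?thesis using \<delta>(2) by (simp add: blinfun.diff_left)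
      qed
      have "\<bar>blinfun_apply w (p (comb l))\<bar> \<le> c"
        using w(2)[rule_format, of "to_nat l"] by (simp add: x_def)
      then show ?thesis
        using diff[OF y] diff[OF p(1), of "comb l"] p(2)[OF y, of "comb l"] by linarith
    qed
    then show "\<bar>blinfun_apply w y\<bar> \<le> 2 * c" by (rule field_le_epsilon)
  qed
qed

subsection \<open>Bounded sets on which null sequences are uniformly null\<close>

text \<open>The bound 2 admits differences of two functionals from the unit ball.\<close>

definition weak_star_null_uniform :: "'a::real_normed_vector set \<Rightarrow> bool"
  where "weak_star_null_uniform C \<longleftrightarrow> (\<forall>f :: nat \<Rightarrow> 'a \<Rightarrow>\<^sub>L real. (\<forall>n. norm (f n) \<le> 2) \<longrightarrow>
    (\<forall>y\<in>C. (\<lambda>n. blinfun_apply (f n) y) \<longlonglongrightarrow> 0) \<longrightarrow>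
    uniform_limit C (\<lambda>n. blinfun_apply (f n)) (\<lambda>_. 0) sequentially)"

lemma weak_star_null_uniformD:
  fixes f :: "nat \<Rightarrow> 'a::real_normed_vector \<Rightarrow>\<^sub>L real"
  assumes "weak_star_null_uniform C" "\<And>n. norm (f n) \<le> 2"
    and "\<And>y. y \<in> C \<Longrightarrow> (\<lambda>n. blinfun_apply (f n) y) \<longlonglongrightarrow> 0"
  shows "uniform_limit C (\<lambda>n. blinfun_apply (f n)) (\<lambda>_. 0) sequentially"
  using assms unfolding weak_star_null_uniform_def by blast

text \<open>Otherwise differences \<open>h (a n) - h (b n)\<close>, with both indices tending to
  infinity, would be null at each point of \<open>C\<close> but not uniformly.\<close>

lemma uniformly_Cauchy_of_null_uniform:
  fixes h :: "nat \<Rightarrow> 'a::real_normed_vector \<Rightarrow>\<^sub>L real"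
  assumes null: "weak_star_null_uniform C"
    and h: "\<And>n. norm (h n) \<le> 1" "\<And>y. y \<in> C \<Longrightarrow> Cauchy (\<lambda>n. blinfun_apply (h n) y)"
  shows "uniformly_Cauchy_on C (\<lambda>n. blinfun_apply (h n))"
proof (rule ccontr)
  assume "\<not> ?thesis"
  then obtain e where e: "e > 0"
    "\<And>M. \<exists>y\<in>C. \<exists>m\<ge>M. \<exists>n\<ge>M. e \<le> dist (blinfun_apply (h m) y) (blinfun_apply (h n) y)"
    unfolding uniformly_Cauchy_on_def by (meson not_less)
  then obtain z a b where zab: "\<And>M. z M \<in> C" "\<And>M. M \<le> a M" "\<And>M. M \<le> b M"
    "\<And>M. e \<le> dist (blinfun_apply (h (a M)) (z M)) (blinfun_apply (h (b M)) (z M))"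
    by metis
  have "uniform_limit C (\<lambda>n. blinfun_apply (h (a n) - h (b n))) (\<lambda>_. 0) sequentially"
  proof (rule weak_star_null_uniformD[OF null])
    show "norm (h (a n) - h (b n)) \<le> 2" for n
      using norm_triangle_ineq4[of "h (a n)" "h (b n)"] h(1)[of "a n"] h(1)[of "b n"] by linarith
  next
    fix y assume "y \<in> C"
    show "(\<lambda>n. blinfun_apply (h (a n) - h (b n)) y) \<longlonglongrightarrow> 0"
    proof (rule metric_LIMSEQ_I)
      fix r :: real assume "r > 0"
      then obtain M where M: "\<forall>m\<ge>M. \<forall>n\<ge>M. dist (blinfun_apply (h m) y) (blinfun_apply (h n) y) < r"
        using metric_CauchyD[OF h(2)[OF \<open>y \<in> C\<close>]] by blast
      have "dist (blinfun_apply (h (a n) - h (b n)) y) 0 < r" if "n \<ge> M" for n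
      proof -
        have "a n \<ge> M" "b n \<ge> M" using zab(2,3)[of n] that by linarith+
        then show ?thesis using M by (auto simp: dist_real_def blinfun.diff_left)
      qed
      then show "\<exists>M. \<forall>n\<ge>M. dist (blinfun_apply (h (a n) - h (b n)) y) 0 < r" by blast
    qed
  qed
  then have "\<forall>\<^sub>F n in sequentially. \<forall>y\<in>C. dist (blinfun_apply (h (a n) - h (b n)) y) 0 < e"
    using e(1) by (rule uniform_limitD)
  then obtain n where "\<forall>y\<in>C. dist (blinfun_apply (h (a n) - h (b n)) y) 0 < e"
    unfolding eventually_sequentially by blast
  then show False
    using zab(1,4)[of n] by (fastforce simp: dist_real_def blinfun.diff_left)
qed

text \<open>The oscillating case cannot occur: it would give a weak* null sequence whose values at
  suitable points of \<open>C\<close> stay at least \<open>d / 2\<close>.\<close>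

lemma convex_block_uniformly_Cauchy:
  fixes f :: "nat \<Rightarrow> 'a::real_normed_vector \<Rightarrow>\<^sub>L real"
  assumes null: "weak_star_null_uniform C"
    and f: "\<And>n. norm (f n) \<le> 1"
  obtains h where "convex_block h f" "uniformly_Cauchy_on C (\<lambda>n. blinfun_apply (h n))"
  using convex_block_dichotomy[of f C]
proof cases
  case (1 g d)
  have "norm (g n) \<le> 1" for n
    using 1(1) f by (rule convex_block_norm_le)
  then obtain \<psi> y where \<psi>: "\<And>i. norm (\<psi> i) \<le> 1" "\<And>i. y i \<in> C" "\<And>i. d / 2 \<le> blinfun_apply (\<psi> i) (y i)"
    "\<And>z. (\<lambda>i. blinfun_apply (\<psi> i) z) \<longlonglongrightarrow> 0"
    using weak_star_null_of_oscillation[of g C d] 1(3) by blast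
  have "uniform_limit C (\<lambda>n. blinfun_apply (\<psi> n)) (\<lambda>_. 0) sequentially"
    by (rule weak_star_null_uniformD[OF null order_trans[OF \<psi>(1)] \<psi>(4)]) simp
  then have "\<forall>\<^sub>F n in sequentially. \<forall>y\<in>C. dist (blinfun_apply (\<psi> n) y) 0 < d / 2"
    by (rule uniform_limitD) (use 1(2) in simp)
  then obtain n where n: "\<forall>y\<in>C. dist (blinfun_apply (\<psi> n) y) 0 < d / 2"
    unfolding eventually_sequentially by blast
  have "dist (blinfun_apply (\<psi> n) (y n)) 0 < d / 2"
    using n \<psi>(2) by blast
  then have False using \<psi>(3)[of n] by (simp add: dist_real_def)
  then show thesis ..
next
  case (2 h)
  have "norm (h n) \<le> 1" for n
    using 2(1) f by (rule convex_block_norm_le)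
  then have "uniformly_Cauchy_on C (\<lambda>n. blinfun_apply (h n))"
    using 2(2) by (intro uniformly_Cauchy_of_null_uniform null)
  then show thesis using that 2(1) by blast
qed

theorem weak_star_null_not_uniform:
  fixes C :: "'a::real_normed_vector set"
  assumes "bounded C" "\<not> totally_bounded C"
  shows "\<not> weak_star_null_uniform C"
proof
  assume null: "weak_star_null_uniform C"
  obtain f :: "nat \<Rightarrow> 'a \<Rightarrow>\<^sub>L real" and d where d: "d > 0" and f: "\<And>n. norm (f n) \<le> 1"
    and sep: "\<forall>m n. m < n \<longrightarrow> (\<exists>y\<in>C. d < \<bar>blinfun_apply (f m) y - blinfun_apply (f n) y\<bar>)"
    by (rule separated_functionals[OF assms]) (rule that)
  have "C \<noteq> {}" using sep zero_less_one by blast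
  obtain x :: "nat \<Rightarrow> 'a" where x: "\<And>k. x k \<in> C"
    and norming: "\<forall>w\<in>span (range f). \<forall>c. (\<forall>k. \<bar>blinfun_apply w (x k)\<bar> \<le> c) \<longrightarrow>
      (\<forall>y\<in>C. \<bar>blinfun_apply w y\<bar> \<le> 2 * c)"
    by (rule half_norming_sequence[OF assms(1) \<open>C \<noteq> {}\<close>, of f]) (rule that)
  have "\<bar>blinfun_apply (f n) (x k)\<bar> \<le> norm (x k)" for n k
    using f by (rule blinfun_abs_le_norm)
  then obtain r where r: "strict_mono r" "\<And>k. convergent (\<lambda>n. blinfun_apply (f (r n)) (x k))"
    by (rule common_convergent_subsequence[of "\<lambda>n k. blinfun_apply (f n) (x k)" "\<lambda>k. norm (x k)"]) blast
  define u where "u n = f (r n)" for n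
  have u: "norm (u n) \<le> 1" for n unfolding u_def by (rule f)
  \<comment> \<open>If two subsequences of \<open>u\<close> had distinct limits \<alpha> and \<beta>
    at \<open>y\<close>, a difference of blocks of them would be small at all \<open>x k\<close>,
    where \<open>u\<close> converges, yet close to \<alpha> - \<beta> at \<open>y\<close>.\<close>
  have "Cauchy (\<lambda>n. blinfun_apply (u n) y)" if "y \<in> C" for y
  proof (rule ccontr)
    assume "\<not> ?thesis"
    then obtain e where e: "e > 0" "\<And>M. \<exists>m\<ge>M. \<exists>n\<ge>M. e \<le> dist (blinfun_apply (u m) y) (blinfun_apply (u n) y)"
      unfolding Cauchy_def by (meson not_less)
    then obtain a b where ab: "\<And>M. M \<le> a M" "\<And>M. M \<le> b M"
      "\<And>M. e \<le> dist (blinfun_apply (u (a M)) y) (blinfun_apply (u (b M)) y)"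
      by metis
    \<comment> \<open>The index \<open>k\<close> merely distinguishes two coordinates, so that one
      \<open>s\<close> makes both subsequences converge at \<open>y\<close>.\<close>
    have "\<bar>blinfun_apply (u (if k = 0 then a n else b n)) y\<bar> \<le> norm y" for n and k :: nat
      using u by (rule blinfun_abs_le_norm)
    then obtain s where s: "strict_mono s"
      "\<And>k :: nat. convergent (\<lambda>n. blinfun_apply (u (if k = 0 then a (s n) else b (s n))) y)"
      by (rule common_convergent_subsequence[of
            "\<lambda>n k. blinfun_apply (u (if k = 0 then a n else b n)) y" "\<lambda>_. norm y"]) blast
    define v where "v n = u (a (s n))" for n
    define v' where "v' n = u (b (s n))" for n
    obtain \<alpha> where \<alpha>: "(\<lambda>n. blinfun_apply (v n) y) \<longlonglongrightarrow> \<alpha>"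
      using s(2)[of 0] by (auto simp: convergent_def v_def)
    obtain \<beta> where \<beta>: "(\<lambda>n. blinfun_apply (v' n) y) \<longlonglongrightarrow> \<beta>"
      using s(2)[of 1] by (auto simp: convergent_def v'_def)
    have "e \<le> dist \<alpha> \<beta>"
      by (rule LIMSEQ_le_const[OF tendsto_dist[OF \<alpha> \<beta>]]) (use ab(3) in \<open>auto simp: v_def v'_def\<close>)
    have "filterlim a at_top sequentially" "filterlim b at_top sequentially"
      using ab(1,2) by (auto intro: filterlim_at_top_mono[OF filterlim_ident])
    then have lim: "filterlim (\<lambda>n. a (s n)) at_top sequentially" "filterlim (\<lambda>n. b (s n)) at_top sequentially"
      by (auto intro: filterlim_compose filterlim_subseq s(1))
    have v: "norm (v n) \<le> 1" "norm (v' n) \<le> 1" for n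
      unfolding v_def v'_def by (rule u)+
    obtain h where h: "convex_block h v" "uniformly_Cauchy_on C (\<lambda>n. blinfun_apply (h n))"
      by (rule convex_block_uniformly_Cauchy[OF null v(1)]) (rule that)
    obtain h' where h': "convex_block h' v'" "uniformly_Cauchy_on C (\<lambda>n. blinfun_apply (h' n))"
      by (rule convex_block_uniformly_Cauchy[OF null v(2)]) (rule that)
    have "e / 8 > 0" using e(1) by simp
    obtain M where M: "\<And>z m n. z \<in> C \<Longrightarrow> m \<ge> M \<Longrightarrow> n \<ge> M \<Longrightarrow>
        dist (blinfun_apply (h m) z) (blinfun_apply (h n) z) < e / 8"
      using h(2) \<open>e / 8 > 0\<close> unfolding uniformly_Cauchy_on_def by blast
    obtain M' where M': "\<And>z m n. z \<in> C \<Longrightarrow> m \<ge> M' \<Longrightarrow> n \<ge> M' \<Longrightarrow>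
        dist (blinfun_apply (h' m) z) (blinfun_apply (h' n) z) < e / 8"
      using h'(2) \<open>e / 8 > 0\<close> unfolding uniformly_Cauchy_on_def by blast
    define N where "N = max M M'"
    \<comment> \<open>Block limits may leave the span of \<open>f\<close>; the terms of index
      \<open>N\<close> stay in it, as \<open>norming\<close> requires, and differ from the limits on
      \<open>C\<close> by at most \<open>e / 8\<close> each.\<close>
    define w where "w = h N - h' N"
    have wlim: "\<bar>blinfun_apply w z - (l - l')\<bar> \<le> e / 4"
      if "z \<in> C" "(\<lambda>n. blinfun_apply (h n) z) \<longlonglongrightarrow> l" "(\<lambda>n. blinfun_apply (h' n) z) \<longlonglongrightarrow> l'" for z l l'
    proof (rule LIMSEQ_le_const2)
      show "(\<lambda>n. \<bar>blinfun_apply w z - (blinfun_apply (h n) z - blinfun_apply (h' n) z)\<bar>)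
          \<longlonglongrightarrow> \<bar>blinfun_apply w z - (l - l')\<bar>"
        by (intro tendsto_intros that)
      have "\<bar>blinfun_apply w z - (blinfun_apply (h n) z - blinfun_apply (h' n) z)\<bar> \<le> e / 4" if "n \<ge> N" for n
      proof -
        have "M \<le> N" "M' \<le> N" by (simp_all add: N_def)
        then show ?thesis
          using M[OF \<open>z \<in> C\<close>, of N n] M'[OF \<open>z \<in> C\<close>, of N n] that
          unfolding w_def blinfun.diff_left dist_real_def by linarith
      qed
      then show "\<exists>N. \<forall>n\<ge>N. \<bar>blinfun_apply w z - (blinfun_apply (h n) z - blinfun_apply (h' n) z)\<bar> \<le> e / 4"
        by blast
    qed
    have "\<bar>blinfun_apply w (x k)\<bar> \<le> e / 4" for k
    proof -
      obtain l where l: "(\<lambda>n. blinfun_apply (u n) (x k)) \<longlonglongrightarrow> l"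
        using r(2)[of k] by (auto simp: convergent_def u_def)
      have "(\<lambda>n. blinfun_apply (h n) (x k)) \<longlonglongrightarrow> l"
        by (rule convex_block_tendsto[OF h(1)])
          (use filterlim_compose[OF l lim(1)] in \<open>simp add: v_def\<close>)
      moreover have "(\<lambda>n. blinfun_apply (h' n) (x k)) \<longlonglongrightarrow> l"
        by (rule convex_block_tendsto[OF h'(1)])
          (use filterlim_compose[OF l lim(2)] in \<open>simp add: v'_def\<close>)
      ultimately show ?thesis using wlim[OF x] by fastforce
    qed
    moreover have "h N \<in> span (range f)" "h' N \<in> span (range f)"
    proof -
      have "v ` {N..} \<subseteq> range f" "v' ` {N..} \<subseteq> range f"
        by (auto simp: v_def v'_def u_def)
      then show "h N \<in> span (range f)" "h' N \<in> span (range f)"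
        using convex_blockD[OF h(1), of N N] convex_blockD[OF h'(1), of N N]
          convex_hull_subset_span span_mono by blast+
    qed
    then have "w \<in> span (range f)"
      unfolding w_def by (rule span_diff)
    ultimately have "\<bar>blinfun_apply w y\<bar> \<le> 2 * (e / 4)"
      using norming that by blast
    moreover have "\<bar>blinfun_apply w y - (\<alpha> - \<beta>)\<bar> \<le> e / 4"
      by (rule wlim[OF that convex_block_tendsto[OF h(1) \<alpha>] convex_block_tendsto[OF h'(1) \<beta>]])
    \<comment> \<open>\<alpha> and \<beta> would be at most \<open>3 * e / 4\<close> apart.\<close>
    ultimately show False
      using \<open>e \<le> dist \<alpha> \<beta>\<close> e(1) unfolding dist_real_def by linarith
  qed
  then have "uniformly_Cauchy_on C (\<lambda>n. blinfun_apply (u n))"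
    by (rule uniformly_Cauchy_of_null_uniform[OF null u])
  then obtain M where "\<And>y m n. y \<in> C \<Longrightarrow> m \<ge> M \<Longrightarrow> n \<ge> M \<Longrightarrow>
      dist (blinfun_apply (u m) y) (blinfun_apply (u n) y) < d"
    using d unfolding uniformly_Cauchy_on_def by blast
  then have "\<bar>blinfun_apply (f (r M)) y - blinfun_apply (f (r (Suc M))) y\<bar> < d" if "y \<in> C" for y
    using that by (fastforce simp: u_def dist_real_def)
  moreover have "r M < r (Suc M)" using r(1) by (simp add: strict_mono_def)
  ultimately show False using sep by (meson less_asym)
qed

subsection \<open>Change of scalars\<close>

text \<open>
  The form \<open>(c, a) \<mapsto> \<langle>1, c a\<rangle>\<close> on the scalar field plays the role of the real part: every real-linear
  functional on the space is \<open>\<langle>1, F y\<rangle>\<close> for a unique scalar-linear \<open>F\<close>. This avoids the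
  classification of the scalar field.
\<close>

lemma trace_form_nondegenerate:
  fixes a :: "'k::{real_normed_field, euclidean_space}"
  assumes "\<And>c. inner 1 (c * a) = 0"
  shows "a = 0"
proof (rule ccontr)
  assume "a \<noteq> 0"
  then have "inner 1 (1 :: 'k) = 0" using assms[of "inverse a"] by simp
  then show False by simp
qed

text \<open>\<open>L a\<close> collects the values on the basis of the functional represented by
  \<open>a\<close>. Nondegeneracy makes \<open>L\<close> injective, hence bijective in finite
  dimension, and \<open>J\<close> is its inverse.\<close>

lemma trace_form_represents:
  obtains J :: "'k::{real_normed_field, euclidean_space} \<Rightarrow> 'k"
  where "linear J" "\<And>v b. b \<in> Basis \<Longrightarrow> inner 1 (b * J v) = inner v b"
proof -
  define L where "L a = (\<Sum>b\<in>Basis. inner 1 (b * a) *\<^sub>R b)" for a :: 'k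
  have L: "inner (L a) b = inner 1 (b * a)" if "b \<in> Basis" for a b
    unfolding L_def using that by simp
  have lin: "linear L"
    by (rule linearI)
      (simp_all add: L_def distrib_left inner_add_right scaleR_add_left sum.distrib scaleR_sum_right)
  have "a = 0" if "L a = 0" for a
  proof (rule trace_form_nondegenerate)
    fix c
    have "inner 1 (c * a) = inner 1 ((\<Sum>b\<in>Basis. inner c b *\<^sub>R b) * a)"
      by (simp add: euclidean_representation)
    also have "\<dots> = (\<Sum>b\<in>Basis. inner c b * inner 1 (b * a))"
      by (simp add: sum_distrib_right inner_sum_right)
    also have "\<dots> = 0"
      using L[of _ a] that by (intro sum.neutral) auto
    finally show "inner 1 (c * a) = 0" .
  qed
  then have "inj L"
    using lin by (simp add: linear_injective_0)
  then obtain J where "linear J" "\<And>x. L (J x) = x"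
    using linear_injective_isomorphism[OF lin] by blast
  then show thesis using that[of J] L by metis
qed

text \<open>For fixed \<open>y\<close> the real functional
  \<open>c \<mapsto> f n (scale c y)\<close> is represented by a unique scalar, which is
  \<open>F n y\<close>; uniqueness yields additivity and homogeneity. The case \<open>c = 1\<close>
  shows that \<open>F\<close> dominates \<open>f\<close>, so a failure of uniform convergence is
  inherited.\<close>

lemma scalar_functionals:
  fixes scale :: "'k::{real_normed_field, euclidean_space} \<Rightarrow> 'a::real_normed_vector \<Rightarrow> 'a"
    and f :: "nat \<Rightarrow> 'a \<Rightarrow>\<^sub>L real"
  assumes scale: "normed_space_over scale"
    and bound: "\<And>n. norm (f n) \<le> B" and null: "\<And>y. (\<lambda>n. blinfun_apply (f n) y) \<longlonglongrightarrow> 0"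
  obtains F :: "nat \<Rightarrow> 'a \<Rightarrow> 'k" and M
  where "\<And>n x y. F n (x + y) = F n x + F n y" "\<And>n c y. F n (scale c y) = c * F n y"
    and "\<And>n y. norm (F n y) \<le> M * norm y" "\<And>y. (\<lambda>n. F n y) \<longlonglongrightarrow> 0"
    and "\<And>n y. \<bar>blinfun_apply (f n) y\<bar> \<le> norm (F n y)"
proof -
  interpret normed_space_over scale by (rule scale)
  obtain J :: "'k \<Rightarrow> 'k" where J: "linear J" "\<And>v b. b \<in> Basis \<Longrightarrow> inner 1 (b * J v) = inner v b"
    by (rule trace_form_represents) (rule that)
  define F where "F n y = J (\<Sum>b\<in>Basis. blinfun_apply (f n) (scale b y) *\<^sub>R b)" for n y
  have trace: "inner 1 (c * F n y) = blinfun_apply (f n) (scale c y)" for c n y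
  proof -
    have "scale (r *\<^sub>R b) y = r *\<^sub>R scale b y" for r b
      by (metis scale_of_real scale_scale scaleR_conv_of_real)
    moreover have "scale c y = scale (\<Sum>b\<in>Basis. inner c b *\<^sub>R b) y"
      by (simp add: euclidean_representation)
    ultimately have "scale c y = (\<Sum>b\<in>Basis. inner c b *\<^sub>R scale b y)"
      by (simp add: scale_sum_left)
    then have "blinfun_apply (f n) (scale c y) = (\<Sum>b\<in>Basis. inner c b * blinfun_apply (f n) (scale b y))"
      by (simp add: blinfun.sum_right blinfun.scaleR_right)
    also have "\<dots> = (\<Sum>b\<in>Basis. inner c b * inner 1 (b * F n y))"
      by (intro sum.cong) (simp_all add: F_def J(2))
    also have "\<dots> = inner 1 ((\<Sum>b\<in>Basis. inner c b *\<^sub>R b) * F n y)"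
      by (simp add: sum_distrib_right inner_sum_right)
    finally show ?thesis by (simp add: euclidean_representation)
  qed
  have eqI: "a = a'" if "\<And>c. inner 1 (c * a) = inner 1 (c * a')" for a a' :: 'k
    using trace_form_nondegenerate[of "a - a'"] that by (simp add: right_diff_distrib inner_diff_right)
  obtain K where K: "K > 0" "\<And>v. norm (J v) \<le> norm v * K"
    using bounded_linear.pos_bounded J(1) linear_conv_bounded_linear by blast
  show thesis
  proof (rule that)
    show "F n (x + y) = F n x + F n y" for n x y
      by (rule eqI) (simp add: trace distrib_left inner_add_right scale_right_distrib blinfun.add_right)
    show "F n (scale c y) = c * F n y" for n c y
    proof (rule eqI)
      fix d
      have "inner 1 (d * F n (scale c y)) = inner 1 ((d * c) * F n y)"
        unfolding trace by simp
      then show "inner 1 (d * F n (scale c y)) = inner 1 (d * (c * F n y))"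
        by (simp add: mult.assoc)
    qed
    show "norm (F n y) \<le> (DIM('k) * B * K) * norm y" for n y
    proof -
      have "norm (blinfun_apply (f n) (scale b y) *\<^sub>R b) \<le> B * norm y" if "b \<in> Basis" for b
      proof -
        have "\<bar>blinfun_apply (f n) (scale b y)\<bar> \<le> norm (f n) * norm (scale b y)"
          using norm_blinfun[of "f n" "scale b y"] by simp
        also have "\<dots> \<le> B * norm (scale b y)"
          by (intro mult_right_mono bound) simp
        finally show ?thesis using that by (simp add: norm_scale)
      qed
      then have "norm (\<Sum>b\<in>Basis. blinfun_apply (f n) (scale b y) *\<^sub>R b) \<le> DIM('k) * (B * norm y)"
        by (rule sum_norm_bound)
      then have "norm (\<Sum>b\<in>Basis. blinfun_apply (f n) (scale b y) *\<^sub>R b) * K \<le> DIM('k) * (B * norm y) * K"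
        using K(1) by (intro mult_right_mono) auto
      then show ?thesis
        using K(2)[of "\<Sum>b\<in>Basis. blinfun_apply (f n) (scale b y) *\<^sub>R b"]
        unfolding F_def by (simp add: ac_simps)
    qed
    show "(\<lambda>n. F n y) \<longlonglongrightarrow> 0" for y
    proof -
      have "(\<lambda>n. \<Sum>b\<in>Basis. blinfun_apply (f n) (scale b y) *\<^sub>R b) \<longlonglongrightarrow> (\<Sum>b\<in>Basis. 0 *\<^sub>R b)"
        by (intro tendsto_sum tendsto_scaleR null tendsto_const)
      then have "(\<lambda>n. F n y) \<longlonglongrightarrow> J (\<Sum>b\<in>Basis. 0 *\<^sub>R b)"
        unfolding F_def using J(1) linear_conv_bounded_linear bounded_linear.tendsto by blast
      then show ?thesis using linear_0[OF J(1)] by simp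
    qed
    show "\<bar>blinfun_apply (f n) y\<bar> \<le> norm (F n y)" for n y
      using trace[of 1 n y] Cauchy_Schwarz_ineq2[of 1 "F n y"] by simp
  qed
qed

subsection \<open>Operators into the space of null sequences\<close>

text \<open>The members of a finite \<open>e / 2\<close>-net have a common index beyond which all of
  them are below \<open>e / 2\<close>.\<close>

lemma totally_bounded_c0_uniform:
  fixes A :: "'a::real_normed_vector c0 set"
  assumes "totally_bounded A" "e > 0"
  obtains N where "\<And>a n. a \<in> A \<Longrightarrow> n \<ge> N \<Longrightarrow> norm (c0_nth a n) < e"
proof -
  obtain K where K: "finite K" "A \<subseteq> (\<Union>x\<in>K. {y. dist x y < e / 2})"
    using assms unfolding totally_bounded_metric by (meson half_gt_zero)
  have "\<forall>\<^sub>F n in sequentially. \<forall>a\<in>K. norm (c0_nth a n) < e / 2"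
  proof (intro eventually_ball_finite K ballI)
    fix a
    show "\<forall>\<^sub>F n in sequentially. norm (c0_nth a n) < e / 2"
      using tendstoD[OF c0_tendsto[of a], of "e / 2"] assms(2) by simp
  qed
  then obtain N where N: "\<And>n a. n \<ge> N \<Longrightarrow> a \<in> K \<Longrightarrow> norm (c0_nth a n) < e / 2"
    unfolding eventually_sequentially by blast
  have "norm (c0_nth a n) < e" if "a \<in> A" "n \<ge> N" for a n
  proof -
    obtain k where k: "k \<in> K" "dist k a < e / 2" using K(2) \<open>a \<in> A\<close> by blast
    have "norm (c0_nth k n - c0_nth a n) < e / 2"
      using norm_c0_nth_le[of "k - a" n] k(2) by (simp add: minus_c0.rep_eq dist_norm)
    then show ?thesis
      using norm_triangle_sub[of "c0_nth a n" "c0_nth k n"] N[OF that(2) k(1)]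
      by (simp add: norm_minus_commute)
  qed
  then show thesis by (rule that)
qed

text \<open>The common bound \<open>B\<close> makes the functionals equicontinuous, so null limits
  pass to the closure.\<close>

lemma weak_star_null_closure:
  fixes f :: "nat \<Rightarrow> 'a::real_normed_vector \<Rightarrow>\<^sub>L real"
  assumes bound: "\<And>n. norm (f n) \<le> B" and null: "\<And>x. x \<in> X \<Longrightarrow> (\<lambda>n. blinfun_apply (f n) x) \<longlonglongrightarrow> 0"
    and y: "y \<in> closure X"
  shows "(\<lambda>n. blinfun_apply (f n) y) \<longlonglongrightarrow> 0"
proof (rule LIMSEQ_I)
  fix e :: real assume "e > 0"
  have B: "B \<ge> 0" using bound[of 0] norm_ge_zero order_trans by blast
  define \<delta> where "\<delta> = e / (2 * (B + 1))"
  have \<delta>: "\<delta> > 0" "B * \<delta> \<le> e / 2"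
    using B \<open>e > 0\<close> by (auto simp: \<delta>_def field_simps)
  obtain x where x: "x \<in> X" "dist x y < \<delta>"
    using y \<delta>(1) unfolding closure_approachable by blast
  obtain N where N: "\<And>n. n \<ge> N \<Longrightarrow> norm (blinfun_apply (f n) x - 0) < e / 2"
    using LIMSEQ_D[OF null[OF x(1)], of "e / 2"] \<open>e > 0\<close> by auto
  have "norm (blinfun_apply (f n) y - 0) < e" if "n \<ge> N" for n
  proof -
    have "norm (blinfun_apply (f n) (y - x)) \<le> norm (f n) * norm (y - x)"
      by (rule norm_blinfun)
    also have "\<dots> \<le> B * \<delta>"
      using bound[of n] x(2) B by (intro mult_mono) (auto simp: dist_norm norm_minus_commute)
    also note \<delta>(2)
    finally show ?thesis
      using N[OF that] unfolding blinfun.diff_right real_norm_def by linarith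
  qed
  then show "\<exists>N. \<forall>n\<ge>N. norm (blinfun_apply (f n) y - 0) < e" by blast
qed

lemma continuous_linear_bounded_linear:
  fixes S :: "'a::real_normed_vector \<Rightarrow> 'b::real_normed_vector"
  assumes "linear S" "continuous_on UNIV S"
  shows "bounded_linear S"
proof -
  interpret linear S by (rule assms(1))
  have "isCont S 0" using assms(2) by (simp add: continuous_on_eq_continuous_at)
  then obtain d where d: "d > 0" "\<And>x. dist x 0 < d \<Longrightarrow> dist (S x) (S 0) < 1"
    unfolding continuous_at_eps_delta by (meson zero_less_one)
  show ?thesis
  proof (rule bounded_linear_intro)
    fix x
    show "norm (S x) \<le> norm x * (2 / d)"
    proof (cases "x = 0")
      case False
      define t where "t = d / (2 * norm x)"
      have "t > 0" using False d(1) by (simp add: t_def)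
      have "norm (t *\<^sub>R x) < d" using False d(1) by (simp add: t_def)
      then have "norm (S (t *\<^sub>R x)) < 1" using d(2)[of "t *\<^sub>R x"] by (simp add: zero)
      then have "t * norm (S x) < 1" using \<open>t > 0\<close> by (simp add: scale)
      then show ?thesis using False d(1) by (simp add: t_def field_simps)
    qed (simp add: zero)
  qed (simp_all add: add scale)
qed

theorem theorem1:
  fixes scaleX :: "'k::{real_normed_field, euclidean_space} \<Rightarrow> 'x::banach \<Rightarrow> 'x"
    and scaleY :: "'k \<Rightarrow> 'y::banach \<Rightarrow> 'y"
    and S :: "'x \<Rightarrow> 'y"
  assumes "normed_space_over scaleX" and "normed_space_over scaleY"
    and "Vector_Spaces.linear scaleX scaleY S" and "continuous_on UNIV S"
    and "\<not> compact_operator S"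
    and "closure (range S) = UNIV"
  shows "\<exists>T :: 'y \<Rightarrow> 'k c0. Vector_Spaces.linear scaleY scale_c0 T \<and> continuous_on UNIV T \<and>
    \<not> compact_operator (T \<circ> S)"
proof -
  interpret X: normed_space_over scaleX by (rule assms(1))
  interpret Y: normed_space_over scaleY by (rule assms(2))
  interpret c0: normed_space_over "scale_c0 :: 'k \<Rightarrow> 'k c0 \<Rightarrow> 'k c0"
    by (rule normed_space_over_scale_c0)
  interpret S: Vector_Spaces.linear scaleX scaleY S by (rule assms(3))
  have "linear S"
    by (rule linearI) (simp_all add: S.add flip: X.scale_of_real Y.scale_of_real add: S.scale)
  then have S: "bounded_linear S"
    using assms(4) by (rule continuous_linear_bounded_linear)
  define C where "C = S ` cball 0 1"
  have "bounded C"
    unfolding C_def using bounded_cball S by (rule bounded_linear_image)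
  moreover have "\<not> totally_bounded C"
    using assms(5) by (simp add: compact_operator_def C_def)
  ultimately have "\<not> weak_star_null_uniform C"
    by (rule weak_star_null_not_uniform)
  then obtain f :: "nat \<Rightarrow> 'y \<Rightarrow>\<^sub>L real" where f: "\<And>n. norm (f n) \<le> 2"
    and null: "\<And>y. y \<in> C \<Longrightarrow> (\<lambda>n. blinfun_apply (f n) y) \<longlonglongrightarrow> 0"
    and nonuniform: "\<not> uniform_limit C (\<lambda>n. blinfun_apply (f n)) (\<lambda>_. 0) sequentially"
    unfolding weak_star_null_uniform_def by blast
  have "(\<lambda>n. blinfun_apply (f n) (S x)) \<longlonglongrightarrow> 0" for x
  proof -
    have "x /\<^sub>R norm x \<in> cball 0 1" by (cases "x = 0") simp_all
    then have "S (x /\<^sub>R norm x) \<in> C" unfolding C_def by (rule imageI)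
    then have "(\<lambda>n. norm x *\<^sub>R blinfun_apply (f n) (S (x /\<^sub>R norm x))) \<longlonglongrightarrow> norm x *\<^sub>R 0"
      by (intro tendsto_scaleR tendsto_const null)
    moreover have "norm x *\<^sub>R blinfun_apply (f n) (S (x /\<^sub>R norm x)) = blinfun_apply (f n) (S x)" for n
      by (cases "x = 0") (simp_all add: linear_cmul[OF \<open>linear S\<close>] blinfun.scaleR_right S.zero)
    ultimately show ?thesis by simp
  qed
  \<comment> \<open>Density of the range enters here; convergence at every \<open>y\<close> is what
    places the sequence \<open>F n y\<close> in \<open>c0\<close>.\<close>
  then have "(\<lambda>n. blinfun_apply (f n) y) \<longlonglongrightarrow> 0" for y
    using weak_star_null_closure[of f 2 "range S" y] f assms(6) by auto
  then obtain F :: "nat \<Rightarrow> 'y \<Rightarrow> 'k" and M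
    where add: "\<And>n x y. F n (x + y) = F n x + F n y" and scale: "\<And>n c y. F n (scaleY c y) = c * F n y"
      and M: "\<And>n y. norm (F n y) \<le> M * norm y" and lim: "\<And>y. (\<lambda>n. F n y) \<longlonglongrightarrow> 0"
      and ge: "\<And>n y. \<bar>blinfun_apply (f n) y\<bar> \<le> norm (F n y)"
    by (rule scalar_functionals[OF assms(2) f]) (rule that)
  define T where "T y = Abs_c0 (\<lambda>n. F n y)" for y
  have T: "c0_nth (T y) n = F n y" for y n
    unfolding T_def by (simp add: Abs_c0_inverse lim)
  have "Vector_Spaces.linear scaleY scale_c0 T"
    by unfold_locales (auto intro!: c0_eqI simp: T add scale plus_c0.rep_eq scale_c0.rep_eq)
  moreover from this interpret T: Vector_Spaces.linear scaleY scale_c0 T .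
  have "bounded_linear T"
  proof (rule bounded_linear_intro)
    show "T (r *\<^sub>R y) = r *\<^sub>R T y" for r y
      using T.scale[of "of_real r" y] by (simp add: Y.scale_of_real c0.scale_of_real)
    show "norm (T y) \<le> norm y * M" for y
      by (rule norm_c0_leI) (use M in \<open>simp add: T mult.commute\<close>)
  qed (rule T.add)
  then have "continuous_on UNIV T"
    by (rule linear_continuous_on)
  moreover have "\<not> compact_operator (T \<circ> S)"
  proof
    assume "compact_operator (T \<circ> S)"
    then have tb: "totally_bounded (T ` C)"
      by (simp add: compact_operator_def C_def image_comp)
    \<comment> \<open>Total boundedness makes the coordinates uniformly small on the image of
      \<open>C\<close>, and \<open>ge\<close> transfers this to \<open>f\<close>.\<close>
    have "uniform_limit C (\<lambda>n. blinfun_apply (f n)) (\<lambda>_. 0) sequentially"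
    proof (rule uniform_limitI)
      fix e :: real assume "e > 0"
      obtain N where N: "\<And>a n. a \<in> T ` C \<Longrightarrow> n \<ge> N \<Longrightarrow> norm (c0_nth a n) < e"
        by (rule totally_bounded_c0_uniform[OF tb \<open>e > 0\<close>]) (rule that)
      have "dist (blinfun_apply (f n) y) 0 < e" if "y \<in> C" "n \<ge> N" for n y
        using N[of "T y" n] ge[of n y] that by (simp add: T dist_real_def)
      then show "\<forall>\<^sub>F n in sequentially. \<forall>y\<in>C. dist (blinfun_apply (f n) y) 0 < e"
        unfolding eventually_sequentially by blast
    qed
    then show False using nonuniform by contradiction
  qed
  ultimately show ?thesis by blast
qed

end
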